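(* Let $n\in\mathbb{N}$. (i) For any $\varepsilon\in(0,1)$ we have $\widehat{\mathbf{DI}}{}_n^{n-1}(\varepsilon)=\mathbf{DI}_n(\varepsilon^{n+1})$. Therefore $\widehat{\mathbf{DI}}{}_n^{n-1}=\mathbf{DI}_n$. (ii) For any $\varepsilon\in(0,1)$ we have $$\widehat{\mathbf{DI}}{}_n^{d}(\varepsilon)\subset\widehat{\mathbf{DI}}{}_n^{d+1}\Big(\varepsilon^{\frac{n-d-1}{n-d}}\Big)\quad\text{if }0\le d\le n-2,$$ and $$\widehat{\mathbf{DI}}{}_n^{d}(\varepsilon)\subset\widehat{\mathbf{DI}}{}_n^{d-1}\Big(\varepsilon^{\frac{d}{d+1}}\Big)\quad\text{if }1\le d\le n-1.$$ Therefore the sets $\widehat{\mathbf{DI}}{}_n^{d}$ are the same for all $d\in\{0,1,\dots,n-1\}$.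
   Context: For $\mathbf{x}\in\mathbb{R}^n$ and $t\ge0$ let $$\mathscr{C}_{\mathbf{x}}(e^t):=\Big\{\mathbf{y}\in\mathbb{R}^{n+1}:|y_i|\le1\ (1\le i\le n),\ \Big|\sum_{i=1}^n y_ix_i+y_{n+1}\Big|\le e^{-t}\Big\},$$ and let $\lambda_{\mathbf{x},i}(t)$ ($1\le i\le n+1$) be its $i$-th successive minimum with respect to $\mathbb{Z}^{n+1}$, i.e. the smallest $\lambda$ such that $\lambda\,\mathscr{C}_{\mathbf{x}}(e^t)$ contains at least $i$ linearly independent points of $\mathbb{Z}^{n+1}$. Put $\lambda^*_{\mathbf{x},i}(t):=e^{-t/(n+1)}\lambda_{\mathbf{x},i}(t)$. For $0\le d\le n-1$ and $0<\varepsilon<1$, $\widehat{\mathbf{DI}}{}_n^{d}(\varepsilon)$ is the set of $\mathbf{x}\in\mathbb{R}^n$ such that $\prod_{i=1}^{n-d}\lambda^*_{\mathbf{x},i}(t)\le\varepsilon$ for all sufficiently large $t>t_0(\mathbf{x},\varepsilon)$ (equivalently $\frac{(n-d)t}{n+1}-\sum_{i=1}^{n-d}\log\lambda_{\mathbf{x},i}(t)\ge\log(1/\varepsilon)$ for all such $t$). Put $\widehat{\mathbf{DI}}{}_n^{d}:=\bigcup_{0<\varepsilon<1}\widehat{\mathbf{DI}}{}_n^{d}(\varepsilon)$. For $\varepsilon\in(0,1)$, $\mathbf{DI}_n(\varepsilon)$ is the set of $\mathbf{x}\in\mathbb{R}^n$ such that for all sufficiently large real $N>N_0(\mathbf{x},\varepsilon)$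 there exists $\mathbf{q}\in\mathbb{Z}^n\setminus\{0\}$ with $\langle\mathbf{q}\cdot\mathbf{x}\rangle\le\varepsilon N^{-n}$ and $\max_i|q_i|\le N$, where $\langle\cdot\rangle$ is distance to the nearest integer; $\mathbf{DI}_n:=\bigcup_{\varepsilon\in(0,1)}\mathbf{DI}_n(\varepsilon)$. *)

theory Defs
  imports "HOL-Analysis.Analysis"
begin

text \<open>
  Throughout, \<open>n = CARD('n)\<close>, which ranges over all positive integers. A point
  \<open>(y\<^sub>1, \<dots>, y\<^sub>n, y\<^sub>n\<^sub>+\<^sub>1)\<close> of the \<open>(n + 1)\<close>-dimensional space is written as a pair
  of a vector in \<open>real ^ 'n\<close> and the last coordinate in \<open>real\<close>.
\<close>

definition convex_body :: "real ^ 'n \<Rightarrow> real \<Rightarrow> ((real ^ 'n) \<times> real) set" where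
  "convex_body x t =
     {(y, z). (\<forall>i. \<bar>y $ i\<bar> \<le> 1) \<and> \<bar>(\<Sum>i\<in>UNIV. y $ i * x $ i) + z\<bar> \<le> exp (- t)}"

definition integer_points :: "((real ^ 'n) \<times> real) set" where
  "integer_points = {(y, z). (\<forall>i. y $ i \<in> \<int>) \<and> z \<in> \<int>}"

text \<open>
  The least element exists for \<open>1 \<le> i \<le> n + 1\<close>: the body is compact with nonempty
  interior and the integer points are discrete. Without \<open>0 < lam\<close> there would be
  none, since the body is symmetric about the origin.
\<close>

definition succ_min :: "real ^ 'n \<Rightarrow> nat \<Rightarrow> real \<Rightarrow> real" where
  "succ_min x i t =
     (LEAST lam. 0 < lam \<and>
        (\<exists>S. S \<subseteq> (\<lambda>v. lam *\<^sub>R v) ` convex_body x t \<inter> integer_points \<and>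
             independent S \<and> i \<le> card S))"

definition normalized_succ_min :: "real ^ 'n \<Rightarrow> nat \<Rightarrow> real \<Rightarrow> real" where
  "normalized_succ_min x i t = exp (- t / (real CARD('n) + 1)) * succ_min x i t"

definition hat_DI_eps :: "nat \<Rightarrow> real \<Rightarrow> (real ^ 'n) set" where
  "hat_DI_eps d \<epsilon> =
     {x. \<forall>\<^sub>F t in at_top. (\<Prod>i = 1..CARD('n) - d. normalized_succ_min x i t) \<le> \<epsilon>}"

definition hat_DI :: "nat \<Rightarrow> (real ^ 'n) set" where
  "hat_DI d = (\<Union>\<epsilon>\<in>{0<..<1}. hat_DI_eps d \<epsilon>)"

definition dist_nearest_int :: "real \<Rightarrow> real" where
  "dist_nearest_int r = \<bar>r - of_int (round r)\<bar>"

definition DI_eps :: "real \<Rightarrow> (real ^ 'n) set" where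
  "DI_eps \<epsilon> =
     {x. \<forall>\<^sub>F N :: real in at_top. \<exists>q :: int ^ 'n. q \<noteq> 0 \<and>
           dist_nearest_int (\<Sum>i\<in>UNIV. of_int (q $ i) * x $ i)
             \<le> \<epsilon> * N powi (- int CARD('n)) \<and>
           of_int (MAX i. \<bar>q $ i\<bar>) \<le> N}"

definition DI :: "(real ^ 'n) set" where
  "DI = (\<Union>\<epsilon>\<in>{0<..<1}. DI_eps \<epsilon>)"

end

theory Submission
  imports Defs
begin

text \<open>
  Write \<open>\<lambda>\<^sub>i\<close> for the normalised successive minima at \<open>t\<close>. They are positive and increase
  with \<open>i\<close>, and everything except the link with Dirichlet's theorem is a
  consequence of these facts and the single inequality \<open>\<lambda>\<^sub>1 \<cdots> \<lambda>\<^sub>n\<^sub>+\<^sub>1 \<le> 1\<close>, for each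
  \<open>t\<close> separately.

  \<^item> Let \<open>P\<^sub>k\<close> be the product of the first \<open>k\<close> of them. Monotonicity gives
    \<open>P\<^sub>k \<le> P\<^sub>k\<^sub>+\<^sub>1 powr (k / (k + 1))\<close>, which is the inclusion from \<open>d\<close> to \<open>d + 1\<close>
    (\<open>prod_initial_le_powr\<close>).

  \<^item> Together with \<open>P\<^sub>n\<^sub>+\<^sub>1 \<le> 1\<close> it gives \<open>P\<^sub>k * \<lambda>\<^sub>k\<^sub>+\<^sub>1 ^ (n + 1 - k) \<le> 1\<close>. With
    \<open>k = n - d\<close> this bounds \<open>P\<^sub>k\<^sub>+\<^sub>1\<close> by \<open>P\<^sub>k powr (d / (d + 1))\<close>, which is the inclusion from
    \<open>d\<close> to \<open>d - 1\<close> (\<open>prod_extend_le_powr\<close>).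

  \<^item> The condition on \<open>\<lambda>\<^sub>1\<close> says that there is a nonzero integer point in a box, and
    this is Dirichlet's condition after the substitution \<open>N = \<epsilon> * exp (t / (n + 1))\<close>
    (\<open>first_min_iff_approximation\<close>).

  The inequality \<open>P\<^sub>n\<^sub>+\<^sub>1 \<le> 1\<close> is Minkowski's second theorem for a body of volume
  \<open>2 ^ (n + 1) * exp (- t)\<close>. It is needed with the sharp constant, since a constant factor would
  spoil the bounds on \<open>\<epsilon>\<close>. It is proved here for open convex sets in any Euclidean space
  (\<open>minkowski_second\<close>), by stretching a packing set from one multiple of the body to the next
  in the directions not yet spanned by lattice points (\<open>stretch_packing\<close>).
\<close>

section \<open>Volumes of linear images\<close>

text \<open>
  Uniqueness of Haar measure. In the double integral of \<open>1\<^sub>A(x) 1\<^sub>B(x + y)\<close>, integrating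
  over \<open>y\<close> first gives the left-hand side; replacing \<open>x\<close> by \<open>x - y\<close> before integrating
  over \<open>y\<close> gives the right-hand side, because Lebesgue measure is symmetric.
\<close>
lemma translation_invariant_proportional_lborel:
  fixes \<mu> :: "'a::euclidean_space measure"
  assumes sf: "sigma_finite_measure \<mu>" and s: "sets \<mu> = sets borel"
    and inv: "\<And>A x. A \<in> sets borel \<Longrightarrow> emeasure \<mu> ((\<lambda>y. y + x) -` A) = emeasure \<mu> A"
    and A: "A \<in> sets borel" and B: "B \<in> sets borel"
  shows "emeasure \<mu> A * emeasure lborel B = emeasure \<mu> B * emeasure lborel A"
proof -
  interpret M: sigma_finite_measure \<mu> by (rule sf)
  interpret P: pair_sigma_finite \<mu> lborel ..
  note [measurable_cong] = s
  note [measurable] = A B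
  have l: "emeasure lborel ((\<lambda>y. x + c *\<^sub>R y) -` S) = emeasure lborel S" 
    if "S \<in> sets borel" "\<bar>c\<bar> = 1" for S c and x :: 'a
  proof -
    have "emeasure lborel S = emeasure (density (distr lborel borel (\<lambda>y. x + c *\<^sub>R y)) (\<lambda>_. \<bar>c\<bar> ^ DIM('a))) S"
      using that by (subst lborel_affine[of c x]) auto
    also have "\<dots> = emeasure lborel ((\<lambda>y. x + c *\<^sub>R y) -` S)"
      using that by (simp add: density_1 emeasure_distr)
    finally show ?thesis by simp
  qed
  have [measurable]: "\<And>x. (\<lambda>y. x + y) -` S \<in> sets borel" "\<And>x. (\<lambda>y. y + x) -` S \<in> sets borel"
    "\<And>x. (\<lambda>y. x - y) -` S \<in> sets borel"
    if [measurable]: "S \<in> sets borel" for S :: "'a set"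
    by (rule measurable_sets_borel[OF _ that]; measurable)+
  have "emeasure \<mu> A * emeasure lborel B = (\<integral>\<^sup>+x. indicator A x * emeasure lborel B \<partial>\<mu>)"
    by (simp add: nn_integral_multc)
  also have "\<dots> = (\<integral>\<^sup>+x. (\<integral>\<^sup>+y. indicator A x * indicator B (x + y) \<partial>lborel) \<partial>\<mu>)"
  proof (rule nn_integral_cong)
    fix x
    have "(\<integral>\<^sup>+y. indicator A x * indicator B (x + y) \<partial>lborel) = indicator A x * (\<integral>\<^sup>+y. indicator ((\<lambda>y. x + y) -` B) y \<partial>lborel)"
      by (subst nn_integral_cmult[symmetric]) (auto simp: indicator_def intro!: nn_integral_cong)
    also have "\<dots> = indicator A x * emeasure lborel B"
      using l[of B 1 x] by simp
    finally show "indicator A x * emeasure lborel B = (\<integral>\<^sup>+y. indicator A x * indicator B (x + y) \<partial>lborel)" by simp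
  qed
  also have "\<dots> = (\<integral>\<^sup>+y. (\<integral>\<^sup>+x. indicator A x * indicator B (x + y) \<partial>\<mu>) \<partial>lborel)"
    by (rule P.Fubini'[symmetric]) measurable
  also have "\<dots> = (\<integral>\<^sup>+y. (\<integral>\<^sup>+x. indicator A (x - y) * indicator B x \<partial>\<mu>) \<partial>lborel)"
  proof (rule nn_integral_cong)
    fix y
    have "(\<integral>\<^sup>+x. indicator A x * indicator B (x + y) \<partial>\<mu>) = emeasure \<mu> (A \<inter> (\<lambda>x. x + y) -` B)"
    proof -
      have "(\<integral>\<^sup>+x. indicator A x * indicator B (x + y) \<partial>\<mu>) = (\<integral>\<^sup>+x. indicator (A \<inter> (\<lambda>x. x + y) -` B) x \<partial>\<mu>)"
        by (intro nn_integral_cong) (auto simp: indicator_def)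
      also have "\<dots> = emeasure \<mu> (A \<inter> (\<lambda>x. x + y) -` B)"
        by (rule nn_integral_indicator) measurable
      finally show ?thesis .
    qed
    also have "\<dots> = emeasure \<mu> ((\<lambda>x. x + y) -` ((\<lambda>x. x + - y) -` A \<inter> B))"
      by (rule arg_cong[where f="emeasure \<mu>"]) auto
    also have "\<dots> = emeasure \<mu> ((\<lambda>x. x + - y) -` A \<inter> B)"
      by (rule inv) measurable
    also have "\<dots> = (\<integral>\<^sup>+x. indicator A (x - y) * indicator B x \<partial>\<mu>)"
    proof -
      have "(\<integral>\<^sup>+x. indicator A (x - y) * indicator B x \<partial>\<mu>) = (\<integral>\<^sup>+x. indicator ((\<lambda>x. x + - y) -` A \<inter> B) x \<partial>\<mu>)"
        by (intro nn_integral_cong) (auto simp: indicator_def)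
      also have "\<dots> = emeasure \<mu> ((\<lambda>x. x + - y) -` A \<inter> B)"
        by (rule nn_integral_indicator) measurable
      finally show ?thesis by simp
    qed
    finally show "(\<integral>\<^sup>+x. indicator A x * indicator B (x + y) \<partial>\<mu>) = (\<integral>\<^sup>+x. indicator A (x - y) * indicator B x \<partial>\<mu>)" .
  qed
  also have "\<dots> = (\<integral>\<^sup>+x. (\<integral>\<^sup>+y. indicator A (x - y) * indicator B x \<partial>lborel) \<partial>\<mu>)"
    by (rule P.Fubini') measurable
  also have "\<dots> = (\<integral>\<^sup>+x. indicator B x * emeasure lborel A \<partial>\<mu>)"
  proof (rule nn_integral_cong)
    fix x
    have "(\<integral>\<^sup>+y. indicator A (x - y) * indicator B x \<partial>lborel) = indicator B x * (\<integral>\<^sup>+y. indicator ((\<lambda>y. x - y) -` A) y \<partial>lborel)"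
      by (subst nn_integral_cmult[symmetric]) (auto simp: indicator_def intro!: nn_integral_cong)
    also have "\<dots> = indicator B x * emeasure lborel A"
      using l[of A "-1" x] by simp
    finally show "(\<integral>\<^sup>+y. indicator A (x - y) * indicator B x \<partial>lborel) = indicator B x * emeasure lborel A" .
  qed
  also have "\<dots> = emeasure \<mu> B * emeasure lborel A"
    by (simp add: nn_integral_multc)
  finally show ?thesis .
qed

lemma linear_bij_image_borel:
  fixes f :: "'a::euclidean_space \<Rightarrow> 'a"
  assumes "linear f" "inj f" "S \<in> sets borel"
  shows "f ` S \<in> sets borel"
proof -
  obtain g where g: "linear g" "g \<circ> f = id" using linear_injective_left_inverse assms by blast
  have "f \<circ> g = id" using g assms
    using linear_inverse_left by blast
  with g have "f ` S = g -` S" 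
    by (auto simp: fun_eq_iff image_iff) metis
  moreover have "g \<in> borel_measurable borel"
    using g by (intro borel_measurable_continuous_onI) (simp add: linear_continuous_on linear_linear)
  ultimately show ?thesis using measurable_sets_borel[of g borel S] assms by simp
qed

text \<open>
  The factor is \<open>\<bar>det f\<bar>\<close>. It is left unspecified because the lemma serves to conjugate a
  diagonal map by \<open>f\<close>, where the factor cancels.
\<close>
lemma emeasure_linear_image:
  fixes f :: "'a::euclidean_space \<Rightarrow> 'a"
  assumes f: "linear f" "inj f"
  obtains c where "\<And>S. S \<in> sets borel \<Longrightarrow> emeasure lborel (f ` S) = c * emeasure lborel S"
proof -
  obtain g where g: "linear g" "g \<circ> f = id" using linear_injective_left_inverse f by blast
  have fg: "f \<circ> g = id" using g f linear_inverse_left by blast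
  have im: "f ` S = g -` S" for S
    using g fg by (auto simp: fun_eq_iff image_iff) metis
  have [measurable]: "g \<in> borel_measurable borel"
    using g by (intro borel_measurable_continuous_onI) (simp add: linear_continuous_on linear_linear)
  define \<mu> where "\<mu> = distr lborel borel g"
  have \<mu>: "emeasure \<mu> S = emeasure lborel (f ` S)" if "S \<in> sets borel" for S
    using that by (simp add: \<mu>_def emeasure_distr im)
  have fin: "emeasure lborel (f ` S) < \<infinity>" if "bounded S" for S
    using bounded_linear_image[OF that] f emeasure_bounded_finite linear_conv_bounded_linear by blast
  have sf: "sigma_finite_measure \<mu>"
  proof
    show "\<exists>A. countable A \<and> A \<subseteq> sets \<mu> \<and> \<Union> A = space \<mu> \<and> (\<forall>a\<in>A. emeasure \<mu> a \<noteq> \<infinity>)"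
    proof (intro exI[of _ "range (\<lambda>n::nat. ball 0 (real n))"] conjI ballI)
      show "\<Union> (range (\<lambda>n::nat. ball 0 (real n))) = space \<mu>"
        by (auto simp: \<mu>_def reals_Archimedean2)
      fix a assume "a \<in> range (\<lambda>n::nat. ball (0::'a) (real n))"
      then show "emeasure \<mu> a \<noteq> \<infinity>" using fin[of a] by (auto simp: \<mu> less_top)
    qed (auto simp: \<mu>_def)
  qed
  have inv: "emeasure \<mu> ((\<lambda>y. y + x) -` A) = emeasure \<mu> A" if A: "A \<in> sets borel" for A x
  proof -
    have A': "(\<lambda>y. y + x) -` A \<in> sets borel" using measurable_sets_borel[of "\<lambda>y. y + x" borel A] A by simp
    have "f ` ((\<lambda>y. y + x) -` A) = (\<lambda>y. f x + y) -` (f ` A)"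
    proof -
      have "g (f x + y) = g y + x" for y
        using g by (simp add: linear_add fun_eq_iff)
      then show ?thesis by (auto simp: im)
    qed
    then have "emeasure \<mu> ((\<lambda>y. y + x) -` A) = emeasure (distr lborel borel ((+) (f x))) (f ` A)"
      using A' A linear_bij_image_borel[OF f A] by (simp add: \<mu> emeasure_distr)
    then show ?thesis using A by (simp add: \<mu> lborel_distr_plus)
  qed
  define Q where "Q = box 0 (One::'a)"
  have Q: "emeasure lborel Q = 1" unfolding Q_def by (subst emeasure_lborel_box) auto
  have eq: "emeasure lborel (f ` S) = emeasure lborel (f ` Q) * emeasure lborel S" if S: "S \<in> sets borel" for S
    using translation_invariant_proportional_lborel[OF sf _ inv S, of Q] S Q by (simp add: \<mu> Q_def) (simp add: \<mu>_def)
  then show ?thesis using that by blast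
qed

text \<open>
  In a basis of the space that starts with a basis of \<open>V\<close>, the map that fixes \<open>V\<close> and
  stretches a complement by \<open>\<rho>\<close> is diagonal. So it is a conjugate of a diagonal map in
  the standard basis and has the same volume factor.
\<close>
lemma transverse_stretch:
  fixes V :: "'a::euclidean_space set"
  assumes V: "subspace V" and \<rho>: "\<rho> > 0"
  obtains P where "linear P" "\<And>x. P x \<in> V" "\<And>x. x \<in> V \<Longrightarrow> P x = x"
    "\<And>S. S \<in> sets borel \<Longrightarrow> (\<lambda>x. P x + \<rho> *\<^sub>R (x - P x)) ` S \<in> sets borel"
    "\<And>S. S \<in> sets borel \<Longrightarrow> emeasure lborel ((\<lambda>x. P x + \<rho> *\<^sub>R (x - P x)) ` S) 
         = ennreal (\<rho> ^ (DIM('a) - dim V)) * emeasure lborel S"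
proof -
  obtain B where B: "B \<subseteq> V" "independent B" "V \<subseteq> span B" "card B = dim V"
    using basis_exists by blast
  obtain C where C: "B \<subseteq> C" "independent C" "UNIV \<subseteq> span C"
    using maximal_independent_subset_extend[of B UNIV] B by auto
  have finC: "finite C" using C independent_imp_finite by blast
  have cardC: "card C = DIM('a)" 
    using C by (metis basis_card_eq_dim dim_UNIV top_greatest)
  have "card B \<le> DIM('a)" using finC C cardC card_mono by metis
  then obtain B' :: "'a set" where B': "B' \<subseteq> Basis" "card B' = card B" "finite B'"
    using obtain_subset_with_card_n[of "card B" "Basis :: 'a set"] by auto
  obtain h1 where h1: "bij_betw h1 B' B" using finite_same_card_bij[of B' B] B' finite_subset[OF C(1) finC] by auto
  have "card (Basis - B') = card (C - B)"
    using B' C(1) finC cardC by (simp add: card_Diff_subset finite_subset[of B C])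
  then obtain h2 where h2: "bij_betw h2 (Basis - B') (C - B)" 
    using finite_same_card_bij[of "Basis - B'" "C - B"] finC by auto
  obtain f where f: "linear f" and fh: "\<And>b. b \<in> Basis \<Longrightarrow> f b = (if b \<in> B' then h1 b else h2 b)"
    using linear_independent_extend[OF independent_Basis, of "\<lambda>b. if b \<in> B' then h1 b else h2 b"] by blast
  have fB: "f ` B' = B" using h1 B' fh by (force simp: bij_betw_def)
  have "f ` (Basis - B') = C - B" using h2 fh by (force simp: bij_betw_def)
  with fB have fC: "f ` Basis = C" using B' C(1) by blast
  have "range f = span C" using linear_span_image[OF f, of Basis] fC by simp
  then have surj: "surj f" using C by auto
  then have inj: "inj f" using linear_surjective_imp_injective f by blast
  have spB: "span B = V" using B V by (simp add: span_minimal subset_antisym)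
  then have fV: "f ` span B' = V" using linear_span_image[OF f, of B'] fB by simp
  obtain g where g: "linear g" "g \<circ> f = id" using linear_injective_left_inverse f inj by blast
  have fg: "f \<circ> g = id" using g f linear_inverse_left by blast
  have gf': "g (f x) = x" and fg': "f (g x) = x" for x using g fg by (auto simp: fun_eq_iff)
  define p where "p x = (\<Sum>b\<in>B'. (x \<bullet> b) *\<^sub>R b)" for x :: 'a
  have linp: "linear p" unfolding p_def
    by (intro linear_compose_sum ballI bounded_linear.linear[OF bounded_linear_scaleR_left[THEN bounded_linear_compose, OF bounded_linear_inner_left]])
  \<comment> \<open>\<open>f\<close> carries the span of \<open>B'\<close> onto \<open>V\<close>, so \<open>P\<close> projects onto \<open>V\<close>.\<close>
  define P where "P = f \<circ> p \<circ> g"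
  have lP: "linear P" unfolding P_def using f g linp by (intro linear_compose)
  have PV: "P x \<in> V" for x
  proof -
    have "p (g x) \<in> span B'" unfolding p_def by (intro span_sum span_scale span_base)
    then show ?thesis using fV by (auto simp: P_def)
  qed
  have pid: "p y = y" if "y \<in> span B'" for y
  proof -
    have "p b = b" if "b \<in> B'" for b
    proof -
      have "p b = (\<Sum>c\<in>B'. if c = b then b else 0)" unfolding p_def
        using that B' by (intro sum.cong) (auto simp: inner_Basis subset_iff)
      then show ?thesis using that B' by simp
    qed
    then show ?thesis using linear_eq_on[OF linp linear_id that] by auto
  qed
  have Pid: "P x = x" if "x \<in> V" for x
    using that fV pid by (auto simp: P_def gf')
  define d where "d b = (if b \<in> B' then 1 else \<rho>)" for b
  define T where "T x = (\<Sum>b\<in>Basis. (d b * (x \<bullet> b)) *\<^sub>R b)" for x :: 'a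
  have T: "T x = p x + \<rho> *\<^sub>R (x - p x)" for x
  proof -
    have "x = (\<Sum>b\<in>Basis. (x \<bullet> b) *\<^sub>R b)" by (simp add: euclidean_representation)
    also have "\<dots> = p x + (\<Sum>b\<in>Basis - B'. (x \<bullet> b) *\<^sub>R b)"
      unfolding p_def using B' by (subst sum.subset_diff[of B' Basis]) auto
    finally have x: "x - p x = (\<Sum>b\<in>Basis - B'. (x \<bullet> b) *\<^sub>R b)" by (simp add: algebra_simps)
    have "T x = (\<Sum>b\<in>B'. (d b * (x \<bullet> b)) *\<^sub>R b) + (\<Sum>b\<in>Basis - B'. (d b * (x \<bullet> b)) *\<^sub>R b)"
      unfolding T_def using B' by (subst sum.subset_diff[of B' Basis]) auto
    also have "(\<Sum>b\<in>B'. (d b * (x \<bullet> b)) *\<^sub>R b) = p x" by (simp add: p_def d_def)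
    also have "(\<Sum>b\<in>Basis - B'. (d b * (x \<bullet> b)) *\<^sub>R b) = \<rho> *\<^sub>R (x - p x)"
      by (simp add: x d_def scaleR_sum_right)
    finally show ?thesis .
  qed
  have prodd: "(\<Prod>b\<in>Basis. \<bar>d b\<bar>) = \<rho> ^ (DIM('a) - dim V)"
  proof -
    have "(\<Prod>b\<in>Basis. \<bar>d b\<bar>) = (\<Prod>b\<in>Basis - B'. \<rho>)"
      using B' \<rho> by (intro prod.mono_neutral_cong_right) (auto simp: d_def)
    then show ?thesis using B' B by (simp add: card_Diff_subset)
  qed
  have linT: "linear T" unfolding T using linp 
    by (simp add: linear_compose_add linear_compose_sub linear_compose_scale_right linear_ident)
  have injT: "inj T"
  proof (rule injI)
    fix x y assume "T x = T y"
    have Tb: "T z \<bullet> b = d b * (z \<bullet> b)" if "b \<in> Basis" for z b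
      unfolding T_def by (rule inner_sum_left_Basis[OF that])
    show "x = y"
    proof (rule euclidean_eqI)
      fix b :: 'a assume b: "b \<in> Basis"
      have "d b \<noteq> 0" using \<rho> by (simp add: d_def)
      then show "x \<bullet> b = y \<bullet> b" using Tb[OF b, of x] Tb[OF b, of y] \<open>T x = T y\<close> by simp
    qed
  qed
  have T_img: "emeasure lborel (T ` S) = ennreal (\<rho> ^ (DIM('a) - dim V)) * emeasure lborel S"
    if S: "S \<in> sets borel" for S
  proof -
    have TS: "T ` S \<in> sets borel" by (rule linear_bij_image_borel[OF linT injT S])
    have [measurable]: "T \<in> borel_measurable borel" unfolding T_def by simp
    have "emeasure lborel (T ` S) = emeasure (density (distr lborel borel (\<lambda>x. 0 + T x)) (\<lambda>_. ennreal (\<Prod>b\<in>Basis. \<bar>d b\<bar>))) (T ` S)"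
      unfolding T_def by (subst lborel_affine_euclidean[of d 0]) (use \<rho> in \<open>auto simp: d_def\<close>)
    also have "\<dots> = ennreal (\<rho> ^ (DIM('a) - dim V)) * emeasure lborel (T -` (T ` S))"
      using TS \<rho> by (simp add: emeasure_density_const emeasure_distr prodd)
    finally show ?thesis using injT by (simp add: inj_vimage_image_eq)
  qed
  have Teq: "(\<lambda>x. P x + \<rho> *\<^sub>R (x - P x)) = f \<circ> T \<circ> g"
    using f by (auto simp: fun_eq_iff P_def T fg' linear_add linear_diff linear_scale)
  have injg: "inj g" by (metis fg' injI)
  obtain c where c: "\<And>S. S \<in> sets borel \<Longrightarrow> emeasure lborel (f ` S) = c * emeasure lborel S" 
    using emeasure_linear_image[OF f inj] by blast
  show ?thesis
  proof (rule that[OF lP PV Pid])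
    fix S :: "'a set" assume S: "S \<in> sets borel"
    have gS: "g ` S \<in> sets borel" using linear_bij_image_borel[OF g(1) injg S] .
    have TgS: "T ` g ` S \<in> sets borel" using linear_bij_image_borel[OF linT injT gS] .
    have im: "(\<lambda>x. P x + \<rho> *\<^sub>R (x - P x)) ` S = f ` T ` g ` S" unfolding Teq by (simp add: image_comp)
    show "(\<lambda>x. P x + \<rho> *\<^sub>R (x - P x)) ` S \<in> sets borel"
      unfolding im using linear_bij_image_borel[OF f inj TgS] .
    have "f ` g ` S = S" by (simp add: image_comp fg)
    then have "emeasure lborel S = c * emeasure lborel (g ` S)"
      using c[OF gS] by simp
    then show "emeasure lborel ((\<lambda>x. P x + \<rho> *\<^sub>R (x - P x)) ` S) 
         = ennreal (\<rho> ^ (DIM('a) - dim V)) * emeasure lborel S"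
      unfolding im using c[OF TgS] T_img[OF gS] by (simp add: ac_simps)
  qed
qed

section \<open>Minkowski's second theorem\<close>
lemma emeasure_lborel_translation:
  fixes S :: "'a::euclidean_space set"
  assumes S: "S \<in> sets borel"
  shows "(\<lambda>y. a + y) ` S \<in> sets borel" "emeasure lborel ((\<lambda>y. a + y) ` S) = emeasure lborel S"
proof -
  have im: "(\<lambda>y. a + y) ` S = ((+) (- a)) -` S"
  proof (intro equalityI subsetI)
    fix x assume "x \<in> ((+) (- a)) -` S"
    then show "x \<in> (\<lambda>y. a + y) ` S" by (intro image_eqI[of _ _ "- a + x"]) auto
  qed auto
  show "(\<lambda>y. a + y) ` S \<in> sets borel"
    unfolding im by (rule measurable_sets_borel[OF _ S]) measurable
  have "emeasure lborel S = emeasure (distr lborel borel ((+) (- a))) S" by (simp add: lborel_distr_plus)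
  also have "\<dots> = emeasure lborel (((+) (- a)) -` S)" using S by (simp add: emeasure_distr)
  finally show "emeasure lborel ((\<lambda>y. a + y) ` S) = emeasure lborel S" unfolding im by simp
qed

text \<open>
  The step of the induction behind Minkowski's second theorem: \<open>E\<close> can be enlarged
  transversally to \<open>V\<close> to fill more of \<open>\<rho> M\<close>, without creating differences in \<open>V\<close> that
  were not there before. The linear stretch \<open>\<phi>\<close>, which fixes \<open>V\<close> and multiplies \<open>x - P x\<close>
  by \<open>\<rho>\<close>, need not map \<open>M\<close> into \<open>\<rho> M\<close>, but it does after each coset of \<open>V\<close> has been moved
  along \<open>V\<close>: if \<open>c\<close> is a point of
  \<open>V\<close> with \<open>c + (x - P x) \<in> M\<close>, then \<open>\<phi> x + (\<rho> - 1) c\<close> is \<open>\<rho>\<close> times a convex combination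
  of \<open>x\<close> and \<open>c + (x - P x)\<close>. Since \<open>M\<close> is open, \<open>c\<close> can be taken from a countable dense
  subset of \<open>V\<close>, so the shifted stretch is affine on each of countably many measurable
  pieces, and its effect on volume is that of \<open>\<phi>\<close>. As \<open>c\<close> depends only on the coset, two points
  whose images differ by an element of \<open>V\<close> receive the same shift.
\<close>
lemma stretch_packing:
  fixes V M E :: "'a::euclidean_space set"
  assumes V: "subspace V" and M: "open M" "convex M" and \<rho>: "\<rho> \<ge> 1"
    and E: "E \<in> sets borel" "E \<subseteq> M"
  obtains E' where "E' \<in> sets borel" "E' \<subseteq> (\<lambda>x. \<rho> *\<^sub>R x) ` M"
    "emeasure lborel E' = ennreal (\<rho> ^ (DIM('a) - dim V)) * emeasure lborel E"
    "\<And>x' y'. x' \<in> E' \<Longrightarrow> y' \<in> E' \<Longrightarrow> x' - y' \<in> V \<Longrightarrow> x' \<noteq> y' \<Longrightarrow> \<exists>x\<in>E. \<exists>y\<in>E. x \<noteq> y \<and> x - y = x' - y'"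
proof -
  have \<rho>0: "\<rho> > 0" using \<rho> by simp
  obtain P where linP: "linear P" and PV: "\<And>x. P x \<in> V" and Pid: "\<And>x. x \<in> V \<Longrightarrow> P x = x"
    and phi: "\<And>S. S \<in> sets borel \<Longrightarrow> (\<lambda>x. P x + \<rho> *\<^sub>R (x - P x)) ` S \<in> sets borel"
    "\<And>S. S \<in> sets borel \<Longrightarrow> emeasure lborel ((\<lambda>x. P x + \<rho> *\<^sub>R (x - P x)) ` S) 
         = ennreal (\<rho> ^ (DIM('a) - dim V)) * emeasure lborel S"
    using transverse_stretch[OF V \<rho>0] by blast
  define \<phi> where "\<phi> x = P x + \<rho> *\<^sub>R (x - P x)" for x
  note phi = phi[folded \<phi>_def]
  obtain D where D: "countable D" "D \<subseteq> V" "V \<subseteq> closure D" using separable[of V] by blast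
  have "D \<noteq> {}" using D(3) V subspace_0 by fastforce
  define c where "c = from_nat_into D"
  have cD: "c k \<in> D" for k unfolding c_def by (rule from_nat_into) fact
  have cV: "c k \<in> V" for k using cD D by blast
  have ex: "\<exists>k. c k + (x - P x) \<in> M" if "x \<in> M" for x
  proof -
    define U where "U = (\<lambda>v. v + (x - P x)) -` M"
    have "open U" unfolding U_def using M(1) by (intro open_vimage continuous_intros)
    moreover have "P x \<in> U" using that by (simp add: U_def)
    moreover have "P x \<in> closure D" using PV D by blast
    ultimately obtain v where "v \<in> D" "v \<in> U"
      by (metis disjoint_iff open_Int_closure_eq_empty)
    moreover obtain k where "c k = v" using \<open>v \<in> D\<close> D unfolding c_def by (metis from_nat_into_surj)
    ultimately show ?thesis by (auto simp: U_def)
  qed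
  define k where "k x = (LEAST k. c k + (x - P x) \<in> M)" for x
  have kM: "c (k x) + (x - P x) \<in> M" if "x \<in> M" for x
    using ex[OF that] unfolding k_def by (rule LeastI_ex)
  have [measurable]: "P \<in> borel_measurable borel"
    using linP by (intro borel_measurable_continuous_onI) (simp add: linear_continuous_on linear_linear)
  have [measurable]: "M \<in> sets borel" using M(1) by (rule borel_open)
  have [measurable]: "k \<in> measurable borel (count_space UNIV)"
    unfolding k_def by measurable
  define Q where "Q j = E \<inter> k -` {j}" for j
  have Qb: "Q j \<in> sets borel" for j
    unfolding Q_def using E(1) measurable_sets[of k borel "count_space UNIV" "{j}"] by auto
  define \<psi> where "\<psi> x = (\<rho> - 1) *\<^sub>R c (k x) + \<phi> x" for x
  have trans: "\<psi> x - P (\<psi> x) = \<rho> *\<^sub>R (x - P x)" for x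
  proof -
    have "P (\<psi> x) = (\<rho> - 1) *\<^sub>R c (k x) + P x"
      using linP by (simp add: \<psi>_def \<phi>_def linear_add linear_scale linear_diff Pid PV cV)
    then show ?thesis by (simp add: \<psi>_def \<phi>_def)
  qed
  have fib: "k x = k y \<and> \<psi> x - \<psi> y = x - y" if "\<psi> x - \<psi> y \<in> V" for x y
  proof -
    have "P (\<psi> x - \<psi> y) = \<psi> x - \<psi> y" by (rule Pid[OF that])
    then have "\<psi> x - P (\<psi> x) = \<psi> y - P (\<psi> y)" using linP by (simp add: linear_diff algebra_simps)
    then have eq: "x - P x = y - P y" using \<rho>0 by (simp add: trans)
    then have "k x = k y" by (simp add: k_def)
    moreover have "\<psi> x - \<psi> y = P x - P y" using \<open>k x = k y\<close> eq by (simp add: \<psi>_def \<phi>_def)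
    moreover have "P x - P y = x - y" using eq by (simp add: algebra_simps)
    ultimately show ?thesis by simp
  qed
  define E' where "E' = \<psi> ` E"
  have E'U: "E' = (\<Union>j. (\<lambda>y. (\<rho> - 1) *\<^sub>R c j + y) ` \<phi> ` Q j)"
    by (auto simp: E'_def \<psi>_def Q_def image_iff)
  have disj: "disjoint_family (\<lambda>j. (\<lambda>y. (\<rho> - 1) *\<^sub>R c j + y) ` \<phi> ` Q j)"
  proof (unfold disjoint_family_on_def, intro ballI impI)
    fix i j :: nat assume "i \<noteq> j"
    have "\<psi> x \<noteq> \<psi> y" if "x \<in> Q i" "y \<in> Q j" for x y
      using fib[of x y] that \<open>i \<noteq> j\<close> subspace_0[OF V] by (auto simp: Q_def)
    then show "(\<lambda>y. (\<rho> - 1) *\<^sub>R c i + y) ` \<phi> ` Q i \<inter> (\<lambda>y. (\<rho> - 1) *\<^sub>R c j + y) ` \<phi> ` Q j = {}"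
      by (auto simp: Q_def \<psi>_def)
  qed
  have "emeasure lborel E' = (\<Sum>j. emeasure lborel ((\<lambda>y. (\<rho> - 1) *\<^sub>R c j + y) ` \<phi> ` Q j))"
    unfolding E'U using disj emeasure_lborel_translation(1)[OF phi(1)[OF Qb]] by (intro suminf_emeasure[symmetric]) auto
  also have "\<dots> = (\<Sum>j. ennreal (\<rho> ^ (DIM('a) - dim V)) * emeasure lborel (Q j))"
    using emeasure_lborel_translation(2)[OF phi(1)[OF Qb]] phi(2)[OF Qb] by simp
  also have "\<dots> = ennreal (\<rho> ^ (DIM('a) - dim V)) * (\<Sum>j. emeasure lborel (Q j))"
    by simp
  also have "(\<Sum>j. emeasure lborel (Q j)) = emeasure lborel (\<Union>j. Q j)"
    using Qb by (intro suminf_emeasure) (auto simp: disjoint_family_on_def Q_def)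
  also have "(\<Union>j. Q j) = E" by (auto simp: Q_def)
  finally have meas: "emeasure lborel E' = ennreal (\<rho> ^ (DIM('a) - dim V)) * emeasure lborel E" .
  show ?thesis
  proof (rule that[OF _ _ meas])
    show "E' \<in> sets borel" unfolding E'U using emeasure_lborel_translation(1)[OF phi(1)[OF Qb]] by auto
    show "E' \<subseteq> (\<lambda>x. \<rho> *\<^sub>R x) ` M"
    proof
      fix z assume "z \<in> E'"
      then obtain x where x: "x \<in> E" "z = \<psi> x" by (auto simp: E'_def)
      define w where "w = (1/\<rho>) *\<^sub>R x + (1 - 1/\<rho>) *\<^sub>R (c (k x) + (x - P x))"
      have "w \<in> M" unfolding w_def using kM[of x] x E \<rho>
        by (intro convexD[OF M(2)]) auto
      moreover have "z = \<rho> *\<^sub>R w"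
      proof -
        have "\<rho> *\<^sub>R w = x + (\<rho> - 1) *\<^sub>R (c (k x) + (x - P x))"
          using \<rho>0 by (simp add: w_def scaleR_add_right right_diff_distrib)
        then show ?thesis by (simp add: x \<psi>_def \<phi>_def algebra_simps)
      qed
      ultimately show "z \<in> (\<lambda>x. \<rho> *\<^sub>R x) ` M" by blast
    qed
    fix x' y' assume "x' \<in> E'" "y' \<in> E'" and d: "x' - y' \<in> V" "x' \<noteq> y'"
    then obtain x y where xy: "x \<in> E" "x' = \<psi> x" "y \<in> E" "y' = \<psi> y" by (auto simp: E'_def)
    show "\<exists>x\<in>E. \<exists>y\<in>E. x \<noteq> y \<and> x - y = x' - y'" 
      using fib[of x y] d xy by (intro bexI[of _ x] bexI[of _ y]) auto
  qed
qed

text \<open>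
  Minkowski's second theorem, with the sharp constant: \<open>\<Lambda>\<close> stands for the lattice, whose
  covolume enters only through the fact that a set with pairwise disjoint translates has volume
  at most \<open>1\<close>, and \<open>M\<close> for half of the open symmetric body, so that the body is \<open>M - M\<close>. The
  proof builds sets \<open>E\<close> inside \<open>lam i M\<close> with disjoint translates, starting with
  \<open>lam 1 M\<close> itself. Going from \<open>i\<close> to \<open>i + 1\<close>, the only elements of \<open>\<Lambda>\<close> that can
  be differences of two points of \<open>lam (i + 1) M\<close> span a space of dimension at most \<open>i\<close>.
  So the stretch along this space multiplies the volume by at least
  \<open>(lam (i + 1) / lam i) ^ (m - i)\<close>, where \<open>m\<close> is the dimension, and keeps the translates
  disjoint. The product of these factors telescopes to the product of the \<open>lam i\<close>.
\<close>
theorem minkowski_second: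
  fixes M \<Lambda> :: "'a::euclidean_space set" and lam :: "nat \<Rightarrow> real"
  assumes M: "open M" "convex M"
    and pos: "lam 1 > 0" and mono: "\<And>i. 1 \<le> i \<Longrightarrow> i < DIM('a) \<Longrightarrow> lam i \<le> lam (Suc i)"
    and dim: "\<And>i. 1 \<le> i \<Longrightarrow> i \<le> DIM('a) \<Longrightarrow> dim {v \<in> \<Lambda>. \<exists>x\<in>M. \<exists>y\<in>M. v = lam i *\<^sub>R (x - y)} < i"
    and density: "\<And>E. E \<in> sets borel \<Longrightarrow> (\<And>x y. x \<in> E \<Longrightarrow> y \<in> E \<Longrightarrow> x - y \<in> \<Lambda> \<Longrightarrow> x = y) \<Longrightarrow> emeasure lborel E \<le> 1"
  shows "ennreal (\<Prod>i=1..DIM('a). lam i) * emeasure lborel M \<le> 1"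
proof -
  let ?m = "DIM('a)"
  let ?D = "\<lambda>i. {v \<in> \<Lambda>. \<exists>x\<in>M. \<exists>y\<in>M. v = lam i *\<^sub>R (x - y)}"
  have lpos: "lam i > 0" if "1 \<le> i" "i \<le> ?m" for i
    using that
  proof (induction i rule: dec_induct)
    case (step n) then show ?case using mono[of n] by auto
  qed (rule pos)
  have "\<exists>E. E \<in> sets borel \<and> E \<subseteq> (\<lambda>x. lam i *\<^sub>R x) ` M \<and>
      (\<forall>x\<in>E. \<forall>y\<in>E. x - y \<in> \<Lambda> \<longrightarrow> x = y) \<and>
      ennreal ((\<Prod>j=1..<i. lam j) * lam i ^ (Suc ?m - i)) * emeasure lborel M \<le> emeasure lborel E" 
    if "1 \<le> i" "i \<le> ?m" for i
    using that
  proof (induction i rule: dec_induct)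
    case base
    obtain E where E: "E \<in> sets borel" "E = (\<lambda>x. lam 1 *\<^sub>R x) ` M" by (metis M(1) borel_open open_scaling order_less_imp_not_eq2 pos)
    have "emeasure lborel E = ennreal (lam 1 ^ ?m) * emeasure lborel M"
    proof -
      have "emeasure lborel E = emeasure (density (distr lborel borel (\<lambda>x. 0 + lam 1 *\<^sub>R x)) (\<lambda>_. \<bar>lam 1\<bar> ^ DIM('a))) E"
        by (subst lborel_affine[of "lam 1" 0]) (use pos in auto)
      also have "\<dots> = ennreal (lam 1 ^ ?m) * emeasure lborel ((\<lambda>x. lam 1 *\<^sub>R x) -` E)"
        using E(1) pos by (simp add: emeasure_density_const emeasure_distr ennreal_power)
      also have "(\<lambda>x. lam 1 *\<^sub>R x) -` E = M" using pos by (auto simp: E)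
      finally show ?thesis .
    qed
    moreover have "x = y" if "x \<in> E" "y \<in> E" "x - y \<in> \<Lambda>" for x y
    proof -
      have "?D 1 \<subseteq> {0}" using dim[of 1] that(1) by simp
      moreover have "x - y \<in> ?D 1" using that by (auto simp: E scaleR_diff_right)
      ultimately have "x - y \<in> {0}" by (rule subsetD)
      then show ?thesis by simp
    qed
    ultimately show ?case using E by (intro exI[of _ E]) auto
  next
    case (step i)
    then obtain E where E: "E \<in> sets borel" "E \<subseteq> (\<lambda>x. lam i *\<^sub>R x) ` M"
      "\<And>x y. x\<in>E \<Longrightarrow> y\<in>E \<Longrightarrow> x - y \<in> \<Lambda> \<Longrightarrow> x = y"
      "ennreal ((\<Prod>j=1..<i. lam j) * lam i ^ (Suc ?m - i)) * emeasure lborel M \<le> emeasure lborel E" by auto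
    define \<rho> where "\<rho> = lam (Suc i) / lam i"
    have li: "lam i > 0" using lpos step by simp
    have \<rho>: "\<rho> \<ge> 1" using mono[of i] li step by (simp add: \<rho>_def)
    define V where "V = span (?D (Suc i))"
    have dV: "dim V \<le> i" using dim[of "Suc i"] step by (simp add: V_def)
    have M': "open ((\<lambda>x. lam i *\<^sub>R x) ` M)" "convex ((\<lambda>x. lam i *\<^sub>R x) ` M)"
      using M li by (auto simp: open_scaling convex_scaling)
    have "subspace V" by (simp add: V_def)
    from stretch_packing[OF this M' \<rho> E(1,2)] obtain E' where E':
      "E' \<in> sets borel" "E' \<subseteq> (\<lambda>x. \<rho> *\<^sub>R x) ` (\<lambda>x. lam i *\<^sub>R x) ` M"
      "emeasure lborel E' = ennreal (\<rho> ^ (?m - dim V)) * emeasure lborel E"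
      "\<And>x' y'. x' \<in> E' \<Longrightarrow> y' \<in> E' \<Longrightarrow> x' - y' \<in> V \<Longrightarrow> x' \<noteq> y' \<Longrightarrow> \<exists>x\<in>E. \<exists>y\<in>E. x \<noteq> y \<and> x - y = x' - y'" by blast
    have sub: "E' \<subseteq> (\<lambda>x. lam (Suc i) *\<^sub>R x) ` M"
      using E'(2) li by (simp add: image_image \<rho>_def)
    have "x' = y'" if "x' \<in> E'" "y' \<in> E'" "x' - y' \<in> \<Lambda>" for x' y'
    proof (rule ccontr)
      assume ne: "x' \<noteq> y'"
      obtain a b where "a \<in> M" "b \<in> M" "x' = lam (Suc i) *\<^sub>R a" "y' = lam (Suc i) *\<^sub>R b" 
        using \<open>x' \<in> E'\<close> \<open>y' \<in> E'\<close> sub by blast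
      then have "x' - y' = lam (Suc i) *\<^sub>R (a - b)" by (simp add: scaleR_diff_right)
      then have "x' - y' \<in> ?D (Suc i)" using \<open>a \<in> M\<close> \<open>b \<in> M\<close> \<open>x' - y' \<in> \<Lambda>\<close> by blast
      then have "x' - y' \<in> V" unfolding V_def by (rule span_base)
      then obtain x y where "x \<in> E" "y \<in> E" "x \<noteq> y" "x - y = x' - y'" 
        using E'(4)[OF \<open>x' \<in> E'\<close> \<open>y' \<in> E'\<close> _ ne] by blast
      then show False using E(3)[of x y] \<open>x' - y' \<in> \<Lambda>\<close> by simp
    qed
    moreover have "ennreal ((\<Prod>j=1..<Suc i. lam j) * lam (Suc i) ^ (Suc ?m - Suc i)) * emeasure lborel M \<le> emeasure lborel E'"
    proof -
      have pr: "(\<Prod>j=1..<i. lam j) \<ge> 0" using lpos step by (intro prod_nonneg) (auto intro: less_imp_le)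
      have "(\<Prod>j=1..<Suc i. lam j) * lam (Suc i) ^ (Suc ?m - Suc i)
         = \<rho> ^ (?m - i) * ((\<Prod>j=1..<i. lam j) * lam i ^ (Suc ?m - i))"
        using step li by (simp add: \<rho>_def power_divide Suc_diff_le)
      also have "\<dots> \<le> \<rho> ^ (?m - dim V) * ((\<Prod>j=1..<i. lam j) * lam i ^ (Suc ?m - i))"
        using \<rho> dV pr li by (intro mult_right_mono power_increasing) auto
      finally have "ennreal ((\<Prod>j=1..<Suc i. lam j) * lam (Suc i) ^ (Suc ?m - Suc i)) * emeasure lborel M
        \<le> ennreal (\<rho> ^ (?m - dim V) * ((\<Prod>j=1..<i. lam j) * lam i ^ (Suc ?m - i))) * emeasure lborel M"
        by (intro mult_right_mono ennreal_leI) auto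
      also have "\<dots> = ennreal (\<rho> ^ (?m - dim V)) * (ennreal ((\<Prod>j=1..<i. lam j) * lam i ^ (Suc ?m - i)) * emeasure lborel M)"
        using \<rho> pr li by (subst ennreal_mult) (auto simp: mult.assoc)
      also have "\<dots> \<le> emeasure lborel E'" unfolding E'(3) by (intro mult_left_mono E(4)) auto
      finally show ?thesis .
    qed
    ultimately show ?case using E'(1) sub by blast
  qed
  \<comment> \<open>At \<open>i = m\<close> the last factor occurs with exponent \<open>1\<close> and completes the product.\<close>
  from this[of ?m] obtain E where E: "E \<in> sets borel" "\<And>x y. x\<in>E \<Longrightarrow> y\<in>E \<Longrightarrow> x - y \<in> \<Lambda> \<Longrightarrow> x = y"
      "ennreal ((\<Prod>j=1..<?m. lam j) * lam ?m ^ (Suc ?m - ?m)) * emeasure lborel M \<le> emeasure lborel E"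
    by (auto simp: Suc_le_eq)
  have "(\<Prod>j=1..<?m. lam j) * lam ?m ^ (Suc ?m - ?m) = (\<Prod>i=1..?m. lam i)"
    by (cases ?m) (auto simp: atLeastLessThanSuc_atLeastAtMost)
  then show ?thesis using E(3) density[OF E(1,2)] by auto
qed

text \<open>
  Blichfeldt's argument: cut \<open>E\<close> along the unit cells and translate the pieces back into one
  cell, where they remain disjoint.
\<close>
lemma packing_integer_points:
  fixes E :: "((real ^ 'n) \<times> real) set"
  assumes E: "E \<in> sets borel"
    and disj: "\<And>x y. x \<in> E \<Longrightarrow> y \<in> E \<Longrightarrow> x - y \<in> integer_points \<Longrightarrow> x = y"
  shows "emeasure lborel E \<le> 1"
proof -
  let ?Z = "integer_points :: ((real ^ 'n) \<times> real) set"
  define fl :: "(real ^ 'n) \<times> real \<Rightarrow> (real ^ 'n) \<times> real" 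
    where "fl v = (\<chi> i. of_int \<lfloor>fst v $ i\<rfloor>, of_int \<lfloor>snd v\<rfloor>)" for v
  have flZ: "fl v \<in> ?Z" for v by (simp add: fl_def integer_points_def)
  have Zdiff: "a - b \<in> ?Z" if "a \<in> ?Z" "b \<in> ?Z" for a b 
    using that by (auto simp: integer_points_def split: prod.splits)
  have cZ: "countable ?Z"
  proof -
    have "?Z \<subseteq> range (\<lambda>(q :: int ^ 'n, p :: int). (\<chi> i. real_of_int (q $ i), real_of_int p))"
    proof
      fix v assume "v \<in> ?Z"
      then have "v = (\<lambda>(q :: int ^ 'n, p :: int). (\<chi> i. real_of_int (q $ i), real_of_int p)) (\<chi> i. \<lfloor>fst v $ i\<rfloor>, \<lfloor>snd v\<rfloor>)"
        by (cases v) (auto simp: integer_points_def vec_eq_iff)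
      then show "v \<in> range (\<lambda>(q :: int ^ 'n, p :: int). (\<chi> i. real_of_int (q $ i), real_of_int p))" by blast
    qed
    moreover have "countable (UNIV :: (int ^ 'n) set)"
    proof -
      have "countable (range (\<lambda>f :: 'n \<Rightarrow> int. \<chi> i. f i))" by (rule countable_image) simp
      moreover have "range (\<lambda>f :: 'n \<Rightarrow> int. \<chi> i. f i) = UNIV"
        by (metis surjI vec_nth_inverse)
      ultimately show ?thesis by simp
    qed
    ultimately show ?thesis by (metis countableI_type countable_SIGMA countable_image countable_subset UNIV_Times_UNIV)
  qed
  define D where "D = cbox (0 :: (real ^ 'n) \<times> real) One"
  have "emeasure lborel D = 1"
    unfolding D_def by (subst emeasure_lborel_cbox) auto
  have flD: "v - fl v \<in> D" for v
  proof -
    have "0 \<le> (v - fl v) \<bullet> b \<and> (v - fl v) \<bullet> b \<le> 1" if "b \<in> Basis" for b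
      using that by (cases v) (auto simp: Basis_prod_def fl_def Basis_vec_def inner_axis; linarith)
    then show ?thesis by (simp add: D_def mem_box)
  qed
  define G where "G g = E \<inter> (fl -` {g})" for g
  have [measurable]: "fl \<in> borel_measurable borel"
  proof -
    have "(\<lambda>v :: (real ^ 'n) \<times> real. real_of_int \<lfloor>fst v $ i\<rfloor>) \<in> borel_measurable borel" for i
      by (intro measurable_compose[OF _ borel_measurable_real_floor] borel_measurable_continuous_onI continuous_intros)
    then have "(\<lambda>v :: (real ^ 'n) \<times> real. \<chi> i. real_of_int \<lfloor>fst v $ i\<rfloor>) \<in> borel_measurable borel"
      by (subst borel_measurable_euclidean_space) (auto simp: Basis_vec_def inner_axis)
    moreover have "(\<lambda>v :: (real ^ 'n) \<times> real. real_of_int \<lfloor>snd v\<rfloor>) \<in> borel_measurable borel"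
      by (intro measurable_compose[OF _ borel_measurable_real_floor] borel_measurable_continuous_onI continuous_intros)
    ultimately show ?thesis unfolding fl_def by (rule borel_measurable_Pair)
  qed
  have Gb: "G g \<in> sets borel" for g unfolding G_def
    using E measurable_sets_borel[of fl borel "{g}"] by auto
  have "emeasure lborel E = emeasure lborel (\<Union>g\<in>?Z. G g)"
    using flZ by (intro arg_cong[where f="emeasure lborel"]) (auto simp: G_def)
  also have "\<dots> = (\<integral>\<^sup>+g. emeasure lborel (G g) \<partial>count_space ?Z)"
    using Gb cZ by (intro emeasure_UN_countable) (auto simp: disjoint_family_on_def G_def)
  also have "\<dots> = (\<integral>\<^sup>+g. emeasure lborel ((\<lambda>y. - g + y) ` G g) \<partial>count_space ?Z)"
    by (simp only: emeasure_lborel_translation(2)[OF Gb])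
  also have "\<dots> = emeasure lborel (\<Union>g\<in>?Z. (\<lambda>y. - g + y) ` G g)"
  proof (rule emeasure_UN_countable[symmetric, OF _ cZ])
    show "disjoint_family_on (\<lambda>g. (\<lambda>y. - g + y) ` G g) ?Z"
    proof (unfold disjoint_family_on_def, intro ballI impI)
      fix g h assume gh: "g \<in> ?Z" "h \<in> ?Z" "g \<noteq> h"
      have False if "x \<in> G g" "y \<in> G h" "- g + x = - h + y" for x y
      proof -
        have "x - y = g - h" using that(3) by (simp add: algebra_simps)
        then have "x = y" using that Zdiff[OF gh(1,2)] by (intro disj) (auto simp: G_def)
        then show False using that gh by simp
      qed
      then show "(\<lambda>y. - g + y) ` G g \<inter> (\<lambda>y. - h + y) ` G h = {}" by blast
    qed
  qed (simp only: sets_lborel emeasure_lborel_translation(1)[OF Gb])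
  also have "\<dots> \<le> emeasure lborel D"
  proof (rule emeasure_mono)
    show "(\<Union>g\<in>?Z. (\<lambda>y. - g + y) ` G g) \<subseteq> D"
    proof
      fix u assume "u \<in> (\<Union>g\<in>?Z. (\<lambda>y. - g + y) ` G g)"
      then obtain g v where "v \<in> G g" "u = - g + v" by blast
      then show "u \<in> D" using flD[of v] by (auto simp: G_def)
    qed
  qed (simp add: D_def)
  finally show ?thesis using \<open>emeasure lborel D = 1\<close> by simp
qed

section \<open>Successive minima\<close>

text \<open>
  The gauge (Minkowski functional) of the convex body: the scaled bodies are its sublevel sets,
  which makes it possible to speak of the minima without images of the body.
\<close>
definition box_gauge :: "real ^ 'n \<Rightarrow> real \<Rightarrow> (real ^ 'n) \<times> real \<Rightarrow> real" where
  "box_gauge x t v = max (Max (range (\<lambda>i. \<bar>fst v $ i\<bar>))) (exp t * \<bar>(\<Sum>i\<in>UNIV. fst v $ i * x $ i) + snd v\<bar>)"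

lemma box_gauge_le_iff:
  "box_gauge x t v \<le> c \<longleftrightarrow> (\<forall>i. \<bar>fst v $ i\<bar> \<le> c) \<and> \<bar>(\<Sum>i\<in>UNIV. fst v $ i * x $ i) + snd v\<bar> \<le> c * exp (- t)"
  by (simp add: box_gauge_def exp_minus pos_le_divide_eq mult.commute[of "exp t"] flip: divide_inverse)

lemma box_gauge_less_iff:
  "box_gauge x t v < c \<longleftrightarrow> (\<forall>i. \<bar>fst v $ i\<bar> < c) \<and> \<bar>(\<Sum>i\<in>UNIV. fst v $ i * x $ i) + snd v\<bar> < c * exp (- t)"
  by (simp add: box_gauge_def exp_minus pos_less_divide_eq mult.commute[of "exp t"] flip: divide_inverse)

lemma mem_scaled_convex_body:
  assumes "c > 0"
  shows "v \<in> (\<lambda>v. c *\<^sub>R v) ` convex_body x t \<longleftrightarrow> box_gauge x t v \<le> c"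
proof -
  have "v \<in> (\<lambda>v. c *\<^sub>R v) ` convex_body x t \<longleftrightarrow> (1 / c) *\<^sub>R v \<in> convex_body x t"
  proof
    assume "(1 / c) *\<^sub>R v \<in> convex_body x t"
    then show "v \<in> (\<lambda>v. c *\<^sub>R v) ` convex_body x t" 
      using assms by (intro image_eqI[of _ _ "(1 / c) *\<^sub>R v"]) auto
  qed (use assms in auto)
  also have "\<dots> \<longleftrightarrow> (\<forall>i. \<bar>fst v $ i / c\<bar> \<le> 1) \<and> \<bar>((\<Sum>i\<in>UNIV. fst v $ i * x $ i) + snd v) / c\<bar> \<le> exp (- t)"
    by (cases v) (simp add: convex_body_def sum_divide_distrib add_divide_distrib)
  also have "\<dots> \<longleftrightarrow> box_gauge x t v \<le> c"
    unfolding box_gauge_le_iff using assms by (simp add: abs_divide divide_le_eq mult.commute)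
  finally show ?thesis .
qed

lemma finite_integer_points_gauge_le:
  fixes x :: "real ^ 'n"
  shows "finite {v \<in> integer_points. box_gauge x t v \<le> c}"
proof -
  define K where "K = \<lceil>max c (c * exp (- t) + (\<Sum>i\<in>UNIV. c * \<bar>x $ i\<bar>))\<rceil>"
  have "{v \<in> integer_points. box_gauge x t v \<le> c} \<subseteq> 
    (\<lambda>(f, p). (\<chi> i. real_of_int (f i), real_of_int p)) ` (Pi\<^sub>E UNIV (\<lambda>_::'n. {-K..K}) \<times> {-K..K})"
  proof
    fix v assume v: "v \<in> {v \<in> integer_points. box_gauge x t v \<le> c}"
    obtain y z where yz: "v = (y, z)" by (cases v)
    have c: "\<bar>y $ i\<bar> \<le> c" for i using v by (simp add: box_gauge_le_iff yz)
    have "\<bar>\<Sum>i\<in>UNIV. y $ i * x $ i\<bar> \<le> (\<Sum>i\<in>UNIV. \<bar>y $ i * x $ i\<bar>)" by (rule sum_abs)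
    also have "\<dots> \<le> (\<Sum>i\<in>UNIV. c * \<bar>x $ i\<bar>)" using c by (intro sum_mono) (simp add: abs_mult mult_right_mono)
    finally have "\<bar>\<Sum>i\<in>UNIV. y $ i * x $ i\<bar> \<le> (\<Sum>i\<in>UNIV. c * \<bar>x $ i\<bar>)" .
    moreover have "\<bar>(\<Sum>i\<in>UNIV. y $ i * x $ i) + z\<bar> \<le> c * exp (- t)" 
      using v by (simp add: box_gauge_le_iff yz)
    ultimately have z: "\<bar>z\<bar> \<le> c * exp (- t) + (\<Sum>i\<in>UNIV. c * \<bar>x $ i\<bar>)" by linarith
    have "max c (c * exp (- t) + (\<Sum>i\<in>UNIV. c * \<bar>x $ i\<bar>)) \<le> K"
      unfolding K_def by (rule le_of_int_ceiling)
    then have K: "c \<le> K" "c * exp (- t) + (\<Sum>i\<in>UNIV. c * \<bar>x $ i\<bar>) \<le> K" 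
      by auto
    have y': "y $ i = of_int \<lfloor>y $ i\<rfloor>" "z = of_int \<lfloor>z\<rfloor>" for i using v by (auto simp: yz integer_points_def)
    have "v = (\<lambda>(f, p). (\<chi> i. real_of_int (f i), real_of_int p)) (\<lambda>i. \<lfloor>y $ i\<rfloor>, \<lfloor>z\<rfloor>)"
      using y' by (simp add: yz vec_eq_iff)
    moreover have "\<lfloor>y $ i\<rfloor> \<in> {-K..K}" for i
    proof -
      have "\<bar>real_of_int \<lfloor>y $ i\<rfloor>\<bar> \<le> K" using c[of i] K(1) y'(1)[of i] by linarith
      then show ?thesis by auto
    qed
    moreover have "\<lfloor>z\<rfloor> \<in> {-K..K}"
    proof -
      have "\<bar>real_of_int \<lfloor>z\<rfloor>\<bar> \<le> K" using z K(2) y'(2) by linarith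
      then show ?thesis by auto
    qed
    ultimately show "v \<in> (\<lambda>(f, p). (\<chi> i. real_of_int (f i), real_of_int p)) ` (Pi\<^sub>E UNIV (\<lambda>_::'n. {-K..K}) \<times> {-K..K})"
      by (intro image_eqI[where x="(\<lambda>i. \<lfloor>y $ i\<rfloor>, \<lfloor>z\<rfloor>)"]) auto
  qed
  then show ?thesis by (rule finite_subset) (auto intro!: finite_imageI finite_cartesian_product finite_PiE)
qed

lemma box_gauge_pos:
  fixes v :: "(real ^ 'n) \<times> real"
  assumes "v \<noteq> 0"
  shows "box_gauge x t v > 0"
proof (rule ccontr)
  assume "\<not> box_gauge x t v > 0"
  then have "box_gauge x t v \<le> 0" by simp
  then have "\<And>i. fst v $ i = 0" "(\<Sum>i\<in>UNIV. fst v $ i * x $ i) + snd v = 0" by (auto simp: box_gauge_le_iff)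
  then have "v = 0" by (cases v) (auto simp: vec_eq_iff prod_eq_iff)
  with assms show False by simp
qed

definition rank_reached :: "real ^ 'n \<Rightarrow> nat \<Rightarrow> real \<Rightarrow> real \<Rightarrow> bool" where
  "rank_reached x i t c \<longleftrightarrow> (\<exists>S \<subseteq> integer_points. independent S \<and> i \<le> card S \<and> (\<forall>v\<in>S. box_gauge x t v \<le> c))"

lemma rank_reached_iff:
  assumes "c > 0"
  shows "(\<exists>S. S \<subseteq> (\<lambda>v. c *\<^sub>R v) ` convex_body x t \<inter> integer_points \<and> independent S \<and> i \<le> card S)
    \<longleftrightarrow> rank_reached x i t c"
proof -
  have "S \<subseteq> (\<lambda>v. c *\<^sub>R v) ` convex_body x t \<inter> integer_points 
      \<longleftrightarrow> S \<subseteq> integer_points \<and> (\<forall>v\<in>S. box_gauge x t v \<le> c)" for S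
    unfolding subset_eq Int_iff mem_scaled_convex_body[OF assms] by (rule iffI; simp)
  then show ?thesis unfolding rank_reached_def by (intro ex_cong1) auto
qed

lemma rank_reached_pos:
  assumes "rank_reached x i t c" "i \<ge> 1"
  shows "c > 0"
proof -
  obtain S where S: "independent S" "i \<le> card S" "\<forall>v\<in>S. box_gauge x t v \<le> c" 
    using assms by (auto simp: rank_reached_def)
  have "S \<noteq> {}" using S(2) assms(2) by auto
  then obtain v where "v \<in> S" by blast
  then have "v \<noteq> 0" using S dependent_zero by metis
  then show ?thesis using box_gauge_pos[of v x t] S \<open>v \<in> S\<close> by fastforce
qed

lemma rank_reached_exists:
  fixes x :: "real ^ 'n"
  assumes "i \<le> CARD('n) + 1"
  shows "\<exists>c. rank_reached x i t c"
proof -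
  let ?B = "Basis :: ((real ^ 'n) \<times> real) set"
  have "?B \<subseteq> integer_points"
    by (auto simp: Basis_prod_def integer_points_def Basis_vec_def axis_def)
  moreover have "\<forall>v\<in>?B. box_gauge x t v \<le> Max (box_gauge x t ` ?B)" by simp
  moreover have "card ?B = CARD('n) + 1" by simp
  ultimately show ?thesis using assms independent_Basis unfolding rank_reached_def by (metis)
qed

text \<open>
  Below any reached level there are only finitely many integer points, hence finitely many
  candidate sets, and one of them minimises the largest gauge.
\<close>
lemma rank_reached_least:
  fixes x :: "real ^ 'n"
  assumes "1 \<le> i" "i \<le> CARD('n) + 1"
  obtains c where "rank_reached x i t c" "\<And>c'. rank_reached x i t c' \<Longrightarrow> c \<le> c'"
proof -
  obtain C where C: "rank_reached x i t C" using rank_reached_exists assms by blast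
  define F where "F = {v \<in> integer_points. box_gauge x t v \<le> C}"
  define \<S> where "\<S> = {S. S \<subseteq> F \<and> independent S \<and> i \<le> card S}"
  define m where "m S = Max (box_gauge x t ` S)" for S
  have "finite F" unfolding F_def by (rule finite_integer_points_gauge_le)
  then have fin: "finite \<S>" unfolding \<S>_def by simp
  have ne: "\<S> \<noteq> {}" using C by (auto simp: rank_reached_def \<S>_def F_def)
  have Sfin: "finite S" "S \<noteq> {}" if "S \<in> \<S>" for S
    using that assms(1) \<open>finite F\<close> by (auto simp: \<S>_def intro: finite_subset)
  obtain S0 where S0: "S0 \<in> \<S>" "\<And>S. S \<in> \<S> \<Longrightarrow> m S0 \<le> m S" 
    using fin ne by (metis arg_min_if_finite(1) arg_min_least)
  show ?thesis
  proof
    have "\<forall>v\<in>S0. box_gauge x t v \<le> m S0" using Sfin[OF S0(1)] by (simp add: m_def)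
    then show r0: "rank_reached x i t (m S0)" 
      using S0(1) by (auto simp: rank_reached_def \<S>_def F_def intro!: exI[of _ S0])
    fix c' assume c': "rank_reached x i t c'"
    then obtain S where S: "S \<subseteq> integer_points" "independent S" "i \<le> card S" "\<forall>v\<in>S. box_gauge x t v \<le> c'" 
      by (auto simp: rank_reached_def)
    have "m S0 \<le> C"
      using S0(1) Sfin[OF S0(1)] by (auto simp: m_def \<S>_def F_def subset_iff)
    show "m S0 \<le> c'"
    proof (cases "c' \<le> C")
      case True
      then have "S \<in> \<S>" using S by (auto simp: \<S>_def F_def intro: order_trans)
      then have "m S0 \<le> m S" "m S \<le> c'" using S0(2) Sfin[of S] S(4) by (auto simp: m_def)
      then show ?thesis by simp
    next
      case False then show ?thesis using \<open>m S0 \<le> C\<close> by simp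
    qed
  qed
qed

lemma succ_min_rank:
  fixes x :: "real ^ 'n"
  assumes "1 \<le> i" "i \<le> CARD('n) + 1"
  shows succ_min_le_iff: "succ_min x i t \<le> c \<longleftrightarrow> rank_reached x i t c"
    and succ_min_pos: "succ_min x i t > 0"
proof -
  obtain c0 where c0: "rank_reached x i t c0" "\<And>c'. rank_reached x i t c' \<Longrightarrow> c0 \<le> c'"
    using rank_reached_least assms by blast
  have "succ_min x i t = (LEAST c. rank_reached x i t c)"
    unfolding succ_min_def using rank_reached_iff[of _ x t i] rank_reached_pos[OF _ assms(1), of x t]
    by (metis (no_types, lifting))
  then have eq: "succ_min x i t = c0" using c0 by (simp add: Least_equality)
  show "succ_min x i t > 0" unfolding eq using rank_reached_pos c0 assms by blast
  have "rank_reached x i t c" if "c0 \<le> c"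
    using c0(1) that unfolding rank_reached_def by (meson order_trans)
  then show "succ_min x i t \<le> c \<longleftrightarrow> rank_reached x i t c" unfolding eq using c0 by blast
qed

lemma succ_min_mono:
  fixes x :: "real ^ 'n"
  assumes "1 \<le> i" "i \<le> j" "j \<le> CARD('n) + 1"
  shows "succ_min x i t \<le> succ_min x j t"
proof -
  have "rank_reached x j t (succ_min x j t)" using assms by (simp flip: succ_min_le_iff)
  then have "rank_reached x i t (succ_min x j t)" using assms unfolding rank_reached_def by (meson order_trans)
  then show ?thesis using assms by (simp add: succ_min_le_iff)
qed

text \<open>
  A basis of the span of these points is finite, so its largest gauge is still below the
  minimum; with \<open>i\<close> elements it would reach rank \<open>i\<close> too early.
\<close>
lemma dim_gauge_less_succ_min:
  fixes x :: "real ^ 'n"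
  assumes "1 \<le> i" "i \<le> CARD('n) + 1"
  shows "dim {v \<in> integer_points. box_gauge x t v < succ_min x i t} < i"
proof (rule ccontr)
  let ?G = "{v \<in> integer_points. box_gauge x t v < succ_min x i t}"
  assume "\<not> ?thesis"
  then have d: "i \<le> dim ?G" by simp
  obtain S where S: "S \<subseteq> ?G" "independent S" "card S = dim ?G" using basis_exists by (rule basis_exists[of ?G]) auto
  have fin: "finite S" by (rule independent_imp_finite[OF S(2)])
  have "card S > 0" using S(3) d assms by linarith
  then have ne: "S \<noteq> {}" by auto
  have "rank_reached x i t (Max (box_gauge x t ` S))"
    unfolding rank_reached_def using S fin d by (intro exI[of _ S]) auto
  then have "succ_min x i t \<le> Max (box_gauge x t ` S)" using assms by (simp add: succ_min_le_iff)
  moreover have "Max (box_gauge x t ` S) < succ_min x i t" using fin ne S by auto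
  ultimately show False by simp
qed

text \<open>
  The volume is computed by slicing along the last coordinate: over each \<open>y\<close> in the cube of
  side \<open>1\<close> lies an interval of length \<open>exp (- t)\<close>.
\<close>
lemma half_box:
  fixes x :: "real ^ 'n"
  shows open_half_box: "open {v. box_gauge x t v < 1 / 2}" 
    and convex_half_box: "convex {v. box_gauge x t v < 1 / 2}" 
    and emeasure_half_box: "emeasure lborel {v. box_gauge x t v < 1 / 2} = ennreal (exp (- t))"
proof -
  define M where "M = {v. box_gauge x t v < 1 / 2}"
  define l where "l v = (\<Sum>i\<in>UNIV. fst v $ i * x $ i) + snd v" for v :: "(real ^ 'n) \<times> real"
  define p where "p i v = fst v $ i" for i and v :: "(real ^ 'n) \<times> real"
  let ?e = "1 / 2 * exp (- t)"
  have abs_iff: "\<bar>a\<bar> < c \<longleftrightarrow> a \<in> {- c<..<c}" for a c :: real by auto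
  have M: "M = (\<Inter>i. p i -` {- (1 / 2)<..<1 / 2}) \<inter> l -` {- ?e<..<?e}"
    unfolding M_def box_gauge_less_iff p_def l_def abs_iff by blast
  have lin: "linear l" "linear (p i)" for i
    unfolding l_def p_def by (auto intro!: linearI simp: algebra_simps sum.distrib sum_distrib_left)
  have cont: "continuous_on UNIV l" "continuous_on UNIV (p i)" for i
    using lin by (simp_all add: linear_continuous_on linear_linear)
  have op: "open M" unfolding M using cont by (intro open_Int open_INT ballI open_vimage) auto
  then show "open {v. box_gauge x t v < 1 / 2}" by (simp add: M_def)
  have "convex M" unfolding M using lin by (intro convex_Int convex_INT convex_linear_vimage) auto
  then show "convex {v. box_gauge x t v < 1 / 2}" by (simp add: M_def)
  define h :: "real ^ 'n" where "h = (\<chi> i. 1 / 2)"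
  define Q where "Q = box (- h) h"
  have "emeasure lborel Q = ennreal (\<Prod>b\<in>Basis. (h - - h) \<bullet> b)"
    unfolding Q_def by (subst emeasure_lborel_box) (auto simp: h_def Basis_vec_def inner_axis)
  also have "(\<Prod>b\<in>Basis. (h - - h) \<bullet> b) = 1"
    by (intro prod.neutral) (auto simp: h_def Basis_vec_def inner_axis)
  finally have Q: "emeasure lborel Q = 1" by simp
  have slice: "Pair y -` M = (if y \<in> Q then {- (\<Sum>i\<in>UNIV. y $ i * x $ i) - ?e<..<- (\<Sum>i\<in>UNIV. y $ i * x $ i) + ?e} else {})" for y
    unfolding M by (auto simp: Q_def h_def mem_box_cart p_def l_def)
  have "M \<in> sets borel" using op by (rule borel_open)
  then have Ms: "M \<in> sets (lborel \<Otimes>\<^sub>M (lborel :: real measure))" unfolding lborel_prod by simp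
  have "emeasure lborel M = emeasure (lborel \<Otimes>\<^sub>M (lborel :: real measure)) M" by (simp add: lborel_prod)
  also have "\<dots> = (\<integral>\<^sup>+y. emeasure lborel (Pair y -` M) \<partial>lborel)"
    by (rule lborel.emeasure_pair_measure_alt[OF Ms])
  also have "\<dots> = (\<integral>\<^sup>+y. ennreal (exp (- t)) * indicator Q y \<partial>lborel)"
    by (intro nn_integral_cong) (auto simp: slice indicator_def)
  also have "\<dots> = ennreal (exp (- t))"
    using Q by (simp add: nn_integral_cmult_indicator Q_def)
  finally show "emeasure lborel {v. box_gauge x t v < 1 / 2} = ennreal (exp (- t))" by (simp add: M_def)
qed

text \<open>
  Minkowski's second theorem for the half box, whose differences have gauge less than \<open>1\<close>.
\<close>
lemma prod_succ_min_le:
  fixes x :: "real ^ 'n"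
  shows "(\<Prod>i=1..CARD('n) + 1. succ_min x i t) \<le> exp t"
proof -
  let ?M = "{v. box_gauge x t v < 1 / 2}"
  let ?lam = "\<lambda>i. succ_min x i t"
  have DIM: "DIM((real ^ 'n) \<times> real) = CARD('n) + 1" by simp
  have less: "box_gauge x t (c *\<^sub>R (a - b)) < c" if "a \<in> ?M" "b \<in> ?M" "c > 0" for a b c
  proof -
    have ab: "\<bar>fst a $ i - fst b $ i\<bar> < 1" for i
    proof -
      have "\<bar>fst a $ i\<bar> < 1 / 2" "\<bar>fst b $ i\<bar> < 1 / 2"
        using that(1,2)[unfolded mem_Collect_eq box_gauge_less_iff] by blast+
      then show ?thesis by linarith
    qed
    have l: "(\<Sum>i\<in>UNIV. fst (c *\<^sub>R (a - b)) $ i * x $ i) + snd (c *\<^sub>R (a - b))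
      = c * (((\<Sum>i\<in>UNIV. fst a $ i * x $ i) + snd a) - ((\<Sum>i\<in>UNIV. fst b $ i * x $ i) + snd b))"
      by (simp add: algebra_simps sum_subtractf sum_distrib_left)
    have "\<bar>((\<Sum>i\<in>UNIV. fst a $ i * x $ i) + snd a) - ((\<Sum>i\<in>UNIV. fst b $ i * x $ i) + snd b)\<bar> < exp (- t)"
      using that(1,2)[unfolded mem_Collect_eq box_gauge_less_iff] by linarith
    then show ?thesis using ab that(3) unfolding box_gauge_less_iff l by (simp add: abs_mult)
  qed
  have "ennreal (\<Prod>i=1..DIM((real ^ 'n) \<times> real). ?lam i) * emeasure lborel ?M \<le> 1"
  proof (rule minkowski_second[where \<Lambda> = integer_points])
    show "dim {v \<in> integer_points. \<exists>y\<in>?M. \<exists>z\<in>?M. v = ?lam i *\<^sub>R (y - z)} < i" 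
      if "1 \<le> i" "i \<le> DIM((real ^ 'n) \<times> real)" for i
    proof (rule le_less_trans[OF dim_subset dim_gauge_less_succ_min])
      show "{v \<in> integer_points. \<exists>y\<in>?M. \<exists>z\<in>?M. v = ?lam i *\<^sub>R (y - z)} \<subseteq> {v \<in> integer_points. box_gauge x t v < succ_min x i t}"
        using less succ_min_pos[of i x t] that by auto
    qed (use that in auto)
    show "?lam i \<le> ?lam (Suc i)" if "1 \<le> i" "i < DIM((real ^ 'n) \<times> real)" for i
      using that by (intro succ_min_mono) auto
    show "emeasure lborel E \<le> 1" if "E \<in> sets borel" 
      "\<And>v w. v \<in> E \<Longrightarrow> w \<in> E \<Longrightarrow> v - w \<in> integer_points \<Longrightarrow> v = w" for E :: "((real ^ 'n) \<times> real) set"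
      using that by (rule packing_integer_points)
    show "open ?M" "convex ?M" by (rule open_half_box convex_half_box)+
    show "?lam 1 > 0" by (rule succ_min_pos) simp_all
  qed
  then have "ennreal (\<Prod>i=1..CARD('n) + 1. ?lam i) * ennreal (exp (- t)) \<le> 1"
    unfolding DIM emeasure_half_box .
  then have "(\<Prod>i=1..CARD('n) + 1. ?lam i) * exp (- t) \<le> 1"
    by (simp flip: ennreal_mult'')
  then show ?thesis by (simp add: exp_minus field_simps)
qed

lemma normalized_succ_min_pos:
  fixes x :: "real ^ 'n"
  assumes "1 \<le> i" "i \<le> CARD('n) + 1"
  shows "normalized_succ_min x i t > 0"
  using succ_min_pos[OF assms] by (simp add: normalized_succ_min_def)

lemma normalized_succ_min_mono:
  fixes x :: "real ^ 'n"
  assumes "1 \<le> i" "i \<le> j" "j \<le> CARD('n) + 1"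
  shows "normalized_succ_min x i t \<le> normalized_succ_min x j t"
  using succ_min_mono[OF assms] by (simp add: normalized_succ_min_def)

lemma prod_normalized_succ_min_le_1:
  fixes x :: "real ^ 'n"
  shows "(\<Prod>i=1..CARD('n) + 1. normalized_succ_min x i t) \<le> 1"
proof -
  let ?m = "CARD('n) + 1"
  have "(\<Prod>i=1..?m. normalized_succ_min x i t) = exp (- t / (real CARD('n) + 1)) ^ ?m * (\<Prod>i=1..?m. succ_min x i t)"
    by (simp only: normalized_succ_min_def prod.distrib prod_constant card_atLeastAtMost) simp
  also have "exp (- t / (real CARD('n) + 1)) ^ ?m = exp (real ?m * (- t / (real CARD('n) + 1)))"
    by (rule exp_of_nat_mult[symmetric])
  also have "real ?m * (- t / (real CARD('n) + 1)) = - t" by (simp add: field_simps)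
  also have "exp (- t) * (\<Prod>i=1..?m. succ_min x i t) \<le> exp (- t) * exp t"
    using prod_succ_min_le[of x t] by (intro mult_left_mono) auto
  finally show ?thesis by (simp flip: exp_add)
qed

section \<open>Comparing products of different length\<close>
lemma le_powr_of_power_le:
  fixes p q :: real
  assumes "p > 0" "q > 0" "k > 0" "p ^ k \<le> q ^ j"
  shows "p \<le> q powr (real j / real k)"
proof -
  have "p = (p ^ k) powr (1 / real k)" using assms by (simp add: powr_powr flip: powr_realpow)
  also have "\<dots> \<le> (q ^ j) powr (1 / real k)" using assms by (intro powr_mono2) auto
  also have "\<dots> = q powr (real j / real k)" using assms by (simp add: powr_powr flip: powr_realpow)
  finally show ?thesis .
qed

text \<open>
  The geometric mean of an increasing sequence does not exceed the one of a longer initial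
  segment.
\<close>
lemma prod_initial_le_powr:
  fixes a :: "nat \<Rightarrow> real"
  assumes pos: "\<And>i. 1 \<le> i \<Longrightarrow> i \<le> k + 1 \<Longrightarrow> a i > 0"
    and mono: "\<And>i. 1 \<le> i \<Longrightarrow> i \<le> k + 1 \<Longrightarrow> a i \<le> a (k + 1)"
  shows "(\<Prod>i=1..k. a i) \<le> (\<Prod>i=1..k + 1. a i) powr (real k / real (k + 1))"
proof (rule le_powr_of_power_le)
  let ?p = "\<Prod>i=1..k. a i"
  show p: "?p > 0" using pos by (intro prod_pos) auto
  show "(\<Prod>i=1..k + 1. a i) > 0" using pos by (intro prod_pos) auto
  have "?p \<le> (\<Prod>i=1..k. a (k + 1))"
    using pos mono by (intro prod_mono) (auto intro: less_imp_le)
  then have "?p \<le> a (k + 1) ^ k" by simp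
  then have "?p ^ k * ?p \<le> ?p ^ k * a (k + 1) ^ k" using p by (intro mult_left_mono) auto
  then show "?p ^ (k + 1) \<le> (\<Prod>i=1..k + 1. a i) ^ k" by (simp add: power_mult_distrib mult.commute)
qed simp

text \<open>
  The \<open>d + 1\<close> factors from \<open>a (k + 1)\<close> on are all at least \<open>a (k + 1)\<close>, and the full product
  is at most \<open>1\<close>. Hence \<open>P * a (k + 1) ^ (d + 1) \<le> 1\<close> for the product \<open>P\<close> of the
  first \<open>k\<close> factors, which bounds the next factor by \<open>P powr (- 1 / (d + 1))\<close>.
\<close>
lemma prod_extend_le_powr:
  fixes a :: "nat \<Rightarrow> real"
  assumes pos: "\<And>i. 1 \<le> i \<Longrightarrow> i \<le> k + d + 1 \<Longrightarrow> a i > 0"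
    and mono: "\<And>i. k + 1 \<le> i \<Longrightarrow> i \<le> k + d + 1 \<Longrightarrow> a (k + 1) \<le> a i"
    and le1: "(\<Prod>i=1..k + d + 1. a i) \<le> 1"
  shows "(\<Prod>i=1..k + 1. a i) \<le> (\<Prod>i=1..k. a i) powr (real d / real (d + 1))"
proof (rule le_powr_of_power_le)
  let ?p = "\<Prod>i=1..k. a i"
  show p: "?p > 0" using pos by (intro prod_pos) auto
  show "(\<Prod>i=1..k + 1. a i) > 0" using pos by (intro prod_pos) auto
  have "a (k + 1) ^ (d + 1) = (\<Prod>i=k + 1..k + d + 1. a (k + 1))" by simp
  also have "\<dots> \<le> (\<Prod>i=k + 1..k + d + 1. a i)"
    using pos mono by (intro prod_mono) (auto intro: less_imp_le)
  finally have "?p * a (k + 1) ^ (d + 1) \<le> ?p * (\<Prod>i=k + 1..k + d + 1. a i)"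
    using p by (intro mult_left_mono) auto
  also have "\<dots> = (\<Prod>i=1..k + d + 1. a i)"
  proof -
    have "{1..k} \<union> {k + 1..k + d + 1} = {1..k + d + 1}" by auto
    then show ?thesis by (subst prod.union_disjoint[symmetric]) (simp_all only: finite_atLeastAtMost, auto)
  qed
  finally have "?p * a (k + 1) ^ (d + 1) \<le> 1" using le1 by simp
  then have "?p ^ d * (?p * a (k + 1) ^ (d + 1)) \<le> ?p ^ d * 1"
    using p by (intro mult_left_mono) auto
  then show "(\<Prod>i=1..k + 1. a i) ^ (d + 1) \<le> ?p ^ d" by (simp add: power_mult_distrib mult_ac)
qed simp

lemma hat_DI_eps_Suc:
  assumes "d + 2 \<le> CARD('n)"
  shows "(hat_DI_eps d \<epsilon> :: (real ^ 'n) set)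
     \<subseteq> hat_DI_eps (d + 1) (\<epsilon> powr ((real CARD('n) - real d - 1) / (real CARD('n) - real d)))"
proof
  fix x :: "real ^ 'n" assume x: "x \<in> hat_DI_eps d \<epsilon>"
  define k where "k = CARD('n) - (d + 1)"
  have k: "CARD('n) - d = k + 1" "real CARD('n) - real d - 1 = real k" "real CARD('n) - real d = real (k + 1)"
    using assms by (auto simp: k_def of_nat_diff)
  have *: "(\<Prod>i = 1..k. normalized_succ_min x i t) \<le> \<epsilon> powr (real k / real (k + 1))"
    if "(\<Prod>i = 1..k + 1. normalized_succ_min x i t) \<le> \<epsilon>" for t
  proof -
    have "(\<Prod>i = 1..k. normalized_succ_min x i t) \<le> (\<Prod>i = 1..k + 1. normalized_succ_min x i t) powr (real k / real (k + 1))"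
      using k(1) by (intro prod_initial_le_powr normalized_succ_min_pos normalized_succ_min_mono) auto
    also have "\<dots> \<le> \<epsilon> powr (real k / real (k + 1))"
      using that k(1) by (intro powr_mono2 prod_nonneg ballI less_imp_le[OF normalized_succ_min_pos]) auto
    finally show ?thesis .
  qed
  from x have "\<forall>\<^sub>F t in at_top. (\<Prod>i = 1..k + 1. normalized_succ_min x i t) \<le> \<epsilon>"
    by (simp add: hat_DI_eps_def k)
  then have "\<forall>\<^sub>F t in at_top. (\<Prod>i = 1..k. normalized_succ_min x i t) \<le> \<epsilon> powr (real k / real (k + 1))"
    by (rule eventually_mono) (rule *)
  then show "x \<in> hat_DI_eps (d + 1) (\<epsilon> powr ((real CARD('n) - real d - 1) / (real CARD('n) - real d)))"
    unfolding hat_DI_eps_def k(2) mem_Collect_eq k_def[symmetric] unfolding k(3) .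
qed

lemma hat_DI_eps_pred:
  assumes "1 \<le> d" "d \<le> CARD('n) - 1"
  shows "(hat_DI_eps d \<epsilon> :: (real ^ 'n) set) \<subseteq> hat_DI_eps (d - 1) (\<epsilon> powr (real d / (real d + 1)))"
proof
  fix x :: "real ^ 'n" assume x: "x \<in> hat_DI_eps d \<epsilon>"
  define k where "k = CARD('n) - d"
  have k: "CARD('n) - (d - 1) = k + 1" "k + d + 1 = CARD('n) + 1"
    using assms by (auto simp: k_def)
  have *: "(\<Prod>i = 1..k + 1. normalized_succ_min x i t) \<le> \<epsilon> powr (real d / (real d + 1))"
    if "(\<Prod>i = 1..k. normalized_succ_min x i t) \<le> \<epsilon>" for t
  proof -
    have "(\<Prod>i = 1..k + 1. normalized_succ_min x i t) \<le> (\<Prod>i = 1..k. normalized_succ_min x i t) powr (real d / real (d + 1))"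
    proof (rule prod_extend_le_powr)
      show "(\<Prod>i = 1..k + d + 1. normalized_succ_min x i t) \<le> 1"
        unfolding k(2) by (rule prod_normalized_succ_min_le_1)
    qed (use k(2) in \<open>auto intro!: normalized_succ_min_pos normalized_succ_min_mono\<close>)
    also have "\<dots> \<le> \<epsilon> powr (real d / real (d + 1))"
      using that k(2) by (intro powr_mono2 prod_nonneg ballI less_imp_le[OF normalized_succ_min_pos]) auto
    finally show ?thesis by (simp add: add.commute)
  qed
  from x have "\<forall>\<^sub>F t in at_top. (\<Prod>i = 1..k. normalized_succ_min x i t) \<le> \<epsilon>"
    by (simp add: hat_DI_eps_def k_def)
  then have "\<forall>\<^sub>F t in at_top. (\<Prod>i = 1..k + 1. normalized_succ_min x i t) \<le> \<epsilon> powr (real d / (real d + 1))"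
    by (rule eventually_mono) (rule *)
  then show "x \<in> hat_DI_eps (d - 1) (\<epsilon> powr (real d / (real d + 1)))"
    unfolding hat_DI_eps_def k mem_Collect_eq .
qed

lemma powr_in_unit_interval:
  fixes \<epsilon> :: real
  assumes "\<epsilon> \<in> {0<..<1}" "s > 0"
  shows "\<epsilon> powr s \<in> {0<..<1}"
  using assms powr_less_mono2[of s \<epsilon> 1] by simp

lemma hat_DI_Suc:
  assumes "d + 2 \<le> CARD('n)"
  shows "(hat_DI d :: (real ^ 'n) set) = hat_DI (d + 1)"
proof (intro equalityI subsetI)
  fix x :: "real ^ 'n" assume "x \<in> hat_DI d"
  then obtain \<epsilon> where e: "\<epsilon> \<in> {0<..<1}" "x \<in> hat_DI_eps d \<epsilon>" unfolding hat_DI_def by blast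
  have "\<epsilon> powr ((real CARD('n) - real d - 1) / (real CARD('n) - real d)) \<in> {0<..<1}"
    using assms by (intro powr_in_unit_interval[OF e(1)] divide_pos_pos) linarith+
  then show "x \<in> hat_DI (d + 1)" unfolding hat_DI_def using e(2) hat_DI_eps_Suc[OF assms] by blast
next
  fix x :: "real ^ 'n" assume "x \<in> hat_DI (d + 1)"
  then obtain \<epsilon> where e: "\<epsilon> \<in> {0<..<1}" "x \<in> hat_DI_eps (d + 1) \<epsilon>" unfolding hat_DI_def by blast
  have "\<epsilon> powr (real (d + 1) / (real (d + 1) + 1)) \<in> {0<..<1}"
    by (intro powr_in_unit_interval[OF e(1)] divide_pos_pos) linarith+
  moreover have "x \<in> hat_DI_eps d (\<epsilon> powr (real (d + 1) / (real (d + 1) + 1)))"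
    using subsetD[OF hat_DI_eps_pred[of "d + 1"] e(2)] assms by simp
  ultimately show "x \<in> hat_DI d" unfolding hat_DI_def by blast
qed

lemma hat_DI_eq_hat_DI_0:
  assumes "d \<le> CARD('n) - 1"
  shows "(hat_DI d :: (real ^ 'n) set) = hat_DI 0"
  using assms
proof (induction d)
  case (Suc d)
  then show ?case using hat_DI_Suc[of d, where 'n = 'n] by simp
qed simp

section \<open>The first minimum and Dirichlet's theorem\<close>
lemma rank_reached_1_iff: "rank_reached x 1 t c \<longleftrightarrow> (\<exists>v\<in>integer_points. v \<noteq> 0 \<and> box_gauge x t v \<le> c)"
proof
  assume "rank_reached x 1 t c"
  then obtain S where S: "S \<subseteq> integer_points" "independent S" "1 \<le> card S" "\<forall>v\<in>S. box_gauge x t v \<le> c"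
    by (auto simp: rank_reached_def)
  then have "S \<noteq> {}" by auto
  then obtain v where "v \<in> S" by blast
  then show "\<exists>v\<in>integer_points. v \<noteq> 0 \<and> box_gauge x t v \<le> c" using S by (metis dependent_zero subsetD)
next
  assume "\<exists>v\<in>integer_points. v \<noteq> 0 \<and> box_gauge x t v \<le> c"
  then obtain v where "v \<in> integer_points" "v \<noteq> 0" "box_gauge x t v \<le> c" by blast
  then show "rank_reached x 1 t c" unfolding rank_reached_def 
    by (intro exI[of _ "{v}"]) (auto simp: dependent_single)
qed

text \<open>
  At this \<open>t\<close> the bound \<open>\<epsilon>\<close> on the normalised minimum allows the integer points of gauge at
  most \<open>\<epsilon> * exp (t / (n + 1)) = N\<close>. For a point \<open>(q, p)\<close> this means \<open>\<bar>q\<^sub>i\<bar> \<le> N\<close> and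
  \<open>\<bar>q \<bullet> x + p\<bar> \<le> N * exp (- t) = \<epsilon> ^ (n + 1) * N ^ (- n)\<close>. The last bound is less
  than \<open>1\<close> when \<open>N \<ge> 1\<close>, so a nonzero point cannot have \<open>q = 0\<close>.
\<close>
lemma first_min_iff_approximation:
  fixes x :: "real ^ 'n"
  assumes \<epsilon>: "\<epsilon> \<in> {0<..<1}" and N: "N \<ge> 1"
  shows "normalized_succ_min x 1 ((real CARD('n) + 1) * ln (N / \<epsilon>)) \<le> \<epsilon> \<longleftrightarrow>
    (\<exists>q :: int ^ 'n. q \<noteq> 0 \<and>
           dist_nearest_int (\<Sum>i\<in>UNIV. of_int (q $ i) * x $ i)
             \<le> \<epsilon> ^ (CARD('n) + 1) * N powi (- int CARD('n)) \<and>
           of_int (MAX i. \<bar>q $ i\<bar>) \<le> N)"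
proof -
  let ?m = "CARD('n) + 1"
  define t where "t = (real CARD('n) + 1) * ln (N / \<epsilon>)"
  define \<delta> where "\<delta> = \<epsilon> ^ ?m * N powi (- int CARD('n))"
  have NE: "N / \<epsilon> > 0" using \<epsilon> N by auto
  have e1: "exp (- t / (real CARD('n) + 1)) = \<epsilon> / N"
    using NE by (simp add: t_def exp_minus add_eq_0_iff)
  have "exp (- t) = exp (real ?m * (- t / (real CARD('n) + 1)))" by (simp add: field_simps)
  also have "\<dots> = exp (- t / (real CARD('n) + 1)) ^ ?m" by (rule exp_of_nat_mult)
  finally have et: "N * exp (- t) = \<delta>" unfolding e1 \<delta>_def using N
    by (simp add: power_divide power_int_minus field_simps)
  have "\<delta> \<le> \<epsilon> ^ ?m * 1" unfolding \<delta>_def using \<epsilon> N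
    by (intro mult_left_mono) (auto simp: power_int_minus inverse_le_1_iff)
  also have "\<dots> < 1" using \<epsilon> power_Suc_less_one[of \<epsilon> "CARD('n)"] by simp
  finally have \<delta>1: "\<delta> < 1" .
  have Max_iff: "of_int (MAX i. \<bar>q $ i\<bar>) \<le> N \<longleftrightarrow> (\<forall>i. \<bar>of_int (q $ i)\<bar> \<le> N)" for q :: "int ^ 'n"
  proof -
    have "of_int (MAX i. \<bar>q $ i\<bar>) \<le> N \<longleftrightarrow> (MAX i. \<bar>q $ i\<bar>) \<le> \<lfloor>N\<rfloor>" by (simp add: le_floor_iff)
    also have "\<dots> \<longleftrightarrow> (\<forall>i. \<bar>q $ i\<bar> \<le> \<lfloor>N\<rfloor>)" by simp
    finally show ?thesis by (simp add: le_floor_iff)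
  qed
  have "normalized_succ_min x 1 t \<le> \<epsilon> \<longleftrightarrow> succ_min x 1 t \<le> N"
    unfolding normalized_succ_min_def e1 using \<epsilon> N by (simp add: field_simps)
  also have "\<dots> \<longleftrightarrow> (\<exists>v\<in>integer_points. v \<noteq> 0 \<and> box_gauge x t v \<le> N)"
    unfolding rank_reached_1_iff[symmetric] by (rule succ_min_le_iff) simp_all
  also have "\<dots> \<longleftrightarrow> (\<exists>q :: int ^ 'n. q \<noteq> 0 \<and>
           dist_nearest_int (\<Sum>i\<in>UNIV. of_int (q $ i) * x $ i) \<le> \<delta> \<and> of_int (MAX i. \<bar>q $ i\<bar>) \<le> N)"
  proof
    assume "\<exists>v\<in>integer_points. v \<noteq> 0 \<and> box_gauge x t v \<le> N"
    then obtain y z where v: "(y, z) \<in> integer_points" "(y, z) \<noteq> 0" "box_gauge x t (y, z) \<le> N"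
      by (metis surj_pair)
    define q :: "int ^ 'n" where "q = (\<chi> i. \<lfloor>y $ i\<rfloor>)"
    have y: "y $ i = of_int (q $ i)" for i using v(1) by (simp add: integer_points_def q_def)
    obtain p where z: "z = of_int p" using v(1) by (auto simp: integer_points_def elim: Ints_cases)
    have g: "\<bar>of_int (q $ i)\<bar> \<le> N" "\<bar>(\<Sum>i\<in>UNIV. of_int (q $ i) * x $ i) + of_int p\<bar> \<le> \<delta>" for i
      using v(3) unfolding box_gauge_le_iff et by (simp_all add: y z)
    have "q \<noteq> 0"
    proof
      assume "q = 0"
      then have "\<bar>real_of_int p\<bar> < 1" using g(2) \<delta>1 by simp
      then have "p = 0" by simp
      then show False using v(2) y z \<open>q = 0\<close> by (auto simp: vec_eq_iff prod_eq_iff)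
    qed
    moreover have "dist_nearest_int (\<Sum>i\<in>UNIV. of_int (q $ i) * x $ i) \<le> \<delta>"
      using g(2) round_diff_minimal[of "\<Sum>i\<in>UNIV. of_int (q $ i) * x $ i" "- p"] by (simp add: dist_nearest_int_def)
    ultimately show "\<exists>q :: int ^ 'n. q \<noteq> 0 \<and>
           dist_nearest_int (\<Sum>i\<in>UNIV. of_int (q $ i) * x $ i) \<le> \<delta> \<and> of_int (MAX i. \<bar>q $ i\<bar>) \<le> N"
      using g(1) Max_iff by blast
  next
    assume "\<exists>q :: int ^ 'n. q \<noteq> 0 \<and>
           dist_nearest_int (\<Sum>i\<in>UNIV. of_int (q $ i) * x $ i) \<le> \<delta> \<and> of_int (MAX i. \<bar>q $ i\<bar>) \<le> N"
    then obtain q :: "int ^ 'n" where q: "q \<noteq> 0" "\<And>i. \<bar>of_int (q $ i)\<bar> \<le> N"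
      "dist_nearest_int (\<Sum>i\<in>UNIV. of_int (q $ i) * x $ i) \<le> \<delta>" unfolding Max_iff by blast
    define v where "v = (\<chi> i. real_of_int (q $ i), - real_of_int (round (\<Sum>i\<in>UNIV. of_int (q $ i) * x $ i)))"
    have "v \<in> integer_points" by (simp add: v_def integer_points_def)
    moreover have "v \<noteq> 0" using q(1) by (auto simp: v_def vec_eq_iff prod_eq_iff)
    moreover have "box_gauge x t v \<le> N" unfolding box_gauge_le_iff et using q(2,3) 
      by (simp add: v_def dist_nearest_int_def)
    ultimately show "\<exists>v\<in>integer_points. v \<noteq> 0 \<and> box_gauge x t v \<le> N" by blast
  qed
  finally show ?thesis unfolding t_def \<delta>_def .
qed

text \<open>
  The substitution \<open>N = \<epsilon> * exp (t / (n + 1))\<close> and its inverse both tend to infinity, so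
  conditions for all large \<open>t\<close> and for all large \<open>N\<close> correspond to each other.
\<close>
lemma hat_DI_eps_eq_DI_eps:
  assumes \<epsilon>: "\<epsilon> \<in> {0<..<1}"
  shows "(hat_DI_eps (CARD('n) - 1) \<epsilon> :: (real ^ 'n) set) = DI_eps (\<epsilon> ^ (CARD('n) + 1))"
proof (intro set_eqI)
  fix x :: "real ^ 'n"
  let ?m = "real CARD('n) + 1"
  let ?P = "\<lambda>t. normalized_succ_min x 1 t \<le> \<epsilon>"
  define Q where "Q N \<longleftrightarrow> (\<exists>q :: int ^ 'n. q \<noteq> 0 \<and>
           dist_nearest_int (\<Sum>i\<in>UNIV. of_int (q $ i) * x $ i)
             \<le> \<epsilon> ^ (CARD('n) + 1) * N powi (- int CARD('n)) \<and>
           of_int (MAX i. \<bar>q $ i\<bar>) \<le> N)" for N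
  have PQ: "?P (?m * ln (N / \<epsilon>)) \<longleftrightarrow> Q N" if "N \<ge> 1" for N
    unfolding Q_def by (rule first_min_iff_approximation[OF \<epsilon> that])
  have "CARD('n) - (CARD('n) - 1) = 1" by (simp add: Suc_leI)
  then have "x \<in> hat_DI_eps (CARD('n) - 1) \<epsilon> \<longleftrightarrow> eventually ?P at_top"
    by (simp add: hat_DI_eps_def)
  also have "\<dots> \<longleftrightarrow> eventually Q at_top"
  proof
    assume P: "eventually ?P at_top"
    have "filterlim (\<lambda>N. ?m * ln (N * (1 / \<epsilon>))) at_top at_top"
      using \<epsilon> by (intro filterlim_tendsto_pos_mult_at_top[OF tendsto_const] filterlim_compose[OF ln_at_top]
        filterlim_at_top_mult_tendsto_pos[OF tendsto_const] filterlim_ident) auto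
    then have "\<forall>\<^sub>F N in at_top. ?P (?m * ln (N * (1 / \<epsilon>)))"
      using P by (auto simp: filterlim_iff)
    then show "eventually Q at_top"
      using eventually_ge_at_top[of 1] by eventually_elim (use PQ in simp)
  next
    assume Q: "eventually Q at_top"
    have "filterlim (\<lambda>t. \<epsilon> * exp (t * (1 / ?m))) at_top at_top"
      using \<epsilon> by (intro filterlim_tendsto_pos_mult_at_top[OF tendsto_const] filterlim_compose[OF exp_at_top]
        filterlim_at_top_mult_tendsto_pos[OF tendsto_const] filterlim_ident) auto
    then have "\<forall>\<^sub>F t in at_top. Q (\<epsilon> * exp (t * (1 / ?m))) \<and> \<epsilon> * exp (t * (1 / ?m)) \<ge> 1"
      using eventually_conj[OF Q eventually_ge_at_top[of 1]] by (auto simp: filterlim_iff)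
    then show "eventually ?P at_top"
    proof eventually_elim
      case (elim t)
      have "?m * ln (\<epsilon> * exp (t * (1 / ?m)) / \<epsilon>) = t" using \<epsilon> by simp
      then show ?case using PQ[of "\<epsilon> * exp (t * (1 / ?m))"] elim by simp
    qed
  qed
  also have "\<dots> \<longleftrightarrow> x \<in> DI_eps (\<epsilon> ^ (CARD('n) + 1))"
    by (simp only: DI_eps_def mem_Collect_eq Q_def[abs_def])
  finally show "x \<in> hat_DI_eps (CARD('n) - 1) \<epsilon> \<longleftrightarrow> x \<in> DI_eps (\<epsilon> ^ (CARD('n) + 1))" .
qed

lemma hat_DI_eq_DI: "(hat_DI (CARD('n) - 1) :: (real ^ 'n) set) = DI"
proof (intro equalityI subsetI)
  fix x :: "real ^ 'n" assume "x \<in> hat_DI (CARD('n) - 1)"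
  then obtain \<epsilon> where e: "\<epsilon> \<in> {0<..<1}" "x \<in> DI_eps (\<epsilon> ^ (CARD('n) + 1))"
    unfolding hat_DI_def using hat_DI_eps_eq_DI_eps[where 'n = 'n] by blast
  have "\<epsilon> ^ (CARD('n) + 1) \<in> {0<..<1}" using e(1) power_Suc_less_one[of \<epsilon> "CARD('n)"] by simp
  then show "x \<in> DI" unfolding DI_def using e(2) by blast
next
  fix x :: "real ^ 'n" assume "x \<in> DI"
  then obtain \<delta> where d: "\<delta> \<in> {0<..<1}" "x \<in> DI_eps \<delta>" unfolding DI_def by blast
  define \<epsilon> where "\<epsilon> = \<delta> powr (1 / real (CARD('n) + 1))"
  have e: "\<epsilon> \<in> {0<..<1}" unfolding \<epsilon>_def by (intro powr_in_unit_interval d(1)) simp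
  have "\<epsilon> ^ (CARD('n) + 1) = \<delta>" unfolding \<epsilon>_def using d(1) 
    by (subst powr_realpow[symmetric]) (simp_all add: powr_powr)
  then show "x \<in> hat_DI (CARD('n) - 1)"
    unfolding hat_DI_def using hat_DI_eps_eq_DI_eps[OF e, where 'n = 'n] d(2) e by blast
qed

theorem lemma4p9:
  shows "(\<forall>\<epsilon>\<in>{0<..<1}.
            (hat_DI_eps (CARD('n) - 1) \<epsilon> :: (real ^ 'n::finite) set)
              = DI_eps (\<epsilon> ^ (CARD('n) + 1))) \<and>
         (hat_DI (CARD('n) - 1) :: (real ^ 'n) set) = DI \<and>
         (\<forall>\<epsilon>\<in>{0<..<1}. \<forall>d. d + 2 \<le> CARD('n) \<longrightarrow>
            (hat_DI_eps d \<epsilon> :: (real ^ 'n) set)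
              \<subseteq> hat_DI_eps (d + 1)
                  (\<epsilon> powr ((real CARD('n) - real d - 1) / (real CARD('n) - real d)))) \<and>
         (\<forall>\<epsilon>\<in>{0<..<1}. \<forall>d. 1 \<le> d \<and> d \<le> CARD('n) - 1 \<longrightarrow>
            (hat_DI_eps d \<epsilon> :: (real ^ 'n) set)
              \<subseteq> hat_DI_eps (d - 1) (\<epsilon> powr (real d / (real d + 1)))) \<and>
         (\<forall>d d'. d \<le> CARD('n) - 1 \<longrightarrow> d' \<le> CARD('n) - 1 \<longrightarrow>
            (hat_DI d :: (real ^ 'n) set) = hat_DI d')"
proof (intro conjI ballI allI impI)
  fix \<epsilon> :: real assume \<epsilon>: "\<epsilon> \<in> {0<..<1}"
  show "(hat_DI_eps (CARD('n) - 1) \<epsilon> :: (real ^ 'n) set) = DI_eps (\<epsilon> ^ (CARD('n) + 1))"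
    by (rule hat_DI_eps_eq_DI_eps[OF \<epsilon>])
next
  show "(hat_DI (CARD('n) - 1) :: (real ^ 'n) set) = DI" by (rule hat_DI_eq_DI)
next
  fix \<epsilon> :: real and d assume "d + 2 \<le> CARD('n)"
  then show "(hat_DI_eps d \<epsilon> :: (real ^ 'n) set)
     \<subseteq> hat_DI_eps (d + 1) (\<epsilon> powr ((real CARD('n) - real d - 1) / (real CARD('n) - real d)))"
    by (rule hat_DI_eps_Suc)
next
  fix \<epsilon> :: real and d assume "1 \<le> d \<and> d \<le> CARD('n) - 1"
  then show "(hat_DI_eps d \<epsilon> :: (real ^ 'n) set) \<subseteq> hat_DI_eps (d - 1) (\<epsilon> powr (real d / (real d + 1)))"
    by (intro hat_DI_eps_pred) auto
next
  fix d d' assume "d \<le> CARD('n) - 1" "d' \<le> CARD('n) - 1"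
  then show "(hat_DI d :: (real ^ 'n) set) = hat_DI d'"
    using hat_DI_eq_hat_DI_0[of d, where 'n = 'n] hat_DI_eq_hat_DI_0[of d', where 'n = 'n] by simp
qed

end
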